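(* Let $n\ge 1$ and $m\ge 2$ be integers. Let $F:\mathbb{R}^n\to\mathbb{R}^n$ be a sufficiently differentiable function in a neighbourhood $D\subset\mathbb{R}^n$ of a point $\alpha$ such that $F(\alpha)=0$, and assume that $F'(\alpha)$ is nonsingular. Let $H:\mathbb{R}^{n\times n}\to\mathbb{R}^{n\times n}$ be a weight function (in the sense described in the context) that satisfies $H(I)=I$, $H_1=-1$ and $H_2=2$. Then, taking initial estimates $x^{(-1)},x^{(0)}$ close enough to $\alpha$: (1) the sequence of iterates $\{x^{(k)}\}_{k\ge 0}$ generated by the method $SWD_m$ converges to $\alpha$ with order $m+\sqrt{m^2+2m-2}$; (2) the sequence of iterates $\{x^{(k)}\}_{k\ge 0}$ generated by the method $SWK_m$ converges to $\alpha$ with order $m+\sqrt{m^2+4m-4}$.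
   Context: Divided differences: for $x,h\in\mathbb{R}^n$ such that the segment from $x$ to $x+h$ lies in $D$, the first-order divided difference operator of $F$ is the $n\times n$ matrix $$[x+h,x;F]=\int_0^1 F'(x+th)\,dt,$$ so that $[y,x;F]=\int_0^1F'(x+t(y-x))\,dt$. The Kurchatov divided difference at $x,y$ is $[2x-y,y;F]$. Weight function: let $X=\mathbb{R}^{n\times n}$ be the Banach space of real $n\times n$ matrices and $I$ the identity matrix. A weight function is a differentiable map $H:X\to X$ whose first and second Fréchet derivatives at $I$ act as multiplication by real constants, $H'(I)(v)=H_1v$ and $H''(I)(v,w)=H_2vw$ with $H_1,H_2\in\mathbb{R}$, in the sense that, as $t\to I$, $$H(t)=H(I)+H_1(t-I)+\tfrac12H_2(t-I)^2+O\left((t-I)^3\right).$$ Methods with memory: given $x^{(-1)},x^{(0)}$, for $k=0,1,2,\dots$ and $n\times n$ matrices $\beta_k,\delta_k$ specified below, put $$w^{(k)}=x^{(k)}+\beta_k F(x^{(k)}),\qquad z_1^{(k)}=x^{(k)}-[w^{(k)},x^{(k)};F]^{-1}F(x^{(k)}),$$ $$v^{(k)}=z_1^{(k)}-\delta_k F(z_1^{(k)}),\qquad t^{(k)}=[w^{(k)},x^{(k)};F]^{-1}[z_1^{(k)},v^{(k)};F],$$ $$z_j^{(k)}=z_{j-1}^{(k)}-H(t^{(k)})[w^{(k)},x^{(k)};F]^{-1}F(z_{j-1}^{(k)}),\qquad j=2,\dots,m,$$ and $x^{(k+1)}=z_m^{(k)}$. The method $SWD_m$ is obtained with $$\beta_k=-[x^{(k)},x^{(k-1)};F]^{-1},\qquad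 \delta_k=2[x^{(k)},x^{(k-1)};F]^{-1}.$$ The method $SWK_m$ is obtained with $$\beta_k=-[2x^{(k)}-x^{(k-1)},x^{(k-1)};F]^{-1},\qquad \delta_k=2[2x^{(k)}-x^{(k-1)},x^{(k-1)};F]^{-1}.$$ Order of convergence: with $e_k=x^{(k)}-\alpha$, convergence with order $p$ is understood in the sense of R-order at least $p$: $x^{(k)}\to\alpha$ and, for every $q$ with $1<q<p$, $\limsup_{k\to\infty}\|e_k\|^{1/q^k}<1$. *)

theory Defs
  imports "HOL-Analysis.Analysis" "HOL-Library.Landau_Symbols"
begin

section \<open>Functions of class $C^k$ on an open set\<close>

primrec Ck_on :: "nat \<Rightarrow> ('a::euclidean_space) set \<Rightarrow> ('a \<Rightarrow> 'b::real_normed_vector) \<Rightarrow> bool" where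
  "Ck_on 0 D f \<longleftrightarrow> continuous_on D f"
| "Ck_on (Suc k) D f \<longleftrightarrow>
     (\<forall>x\<in>D. f differentiable (at x)) \<and>
     (\<forall>v. Ck_on k D (\<lambda>x. frechet_derivative f (at x) v))"


section \<open>Divided differences\<close>

(* divdiff F y x is [y, x; F]; it is meaningful when the segment from x to y lies in
   the region where F is continuously differentiable. *)
definition divdiff :: "(real^'n \<Rightarrow> real^'n) \<Rightarrow> real^'n \<Rightarrow> real^'n \<Rightarrow> real^'n^'n" where
  "divdiff F y x = integral {0..1} (\<lambda>t. jacobian F (at (x + t *\<^sub>R (y - x))))"


section \<open>Weight functions\<close>

(* The condition on the second derivative is the second-order expansion at the identity.
   Requiring H''(I)(v,w) = H2 v w for all v and w as a bilinear map would be
   inconsistent with the symmetry of second Frechet derivatives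
   when H2 is nonzero and n > 1, because matrices do not commute.
   The condition on H'(I) follows from the expansion. *)
definition weight_function ::
    "(real^'n^'n \<Rightarrow> real^'n^'n) \<Rightarrow> real \<Rightarrow> real \<Rightarrow> bool" where
  "weight_function H H1 H2 \<longleftrightarrow>
     (\<forall>A. H differentiable (at A)) \<and>
     (H has_derivative (\<lambda>v. H1 *\<^sub>R v)) (at (mat 1)) \<and>
     (\<lambda>t. norm (H t - (H (mat 1) + H1 *\<^sub>R (t - mat 1)
                       + (H2 / 2) *\<^sub>R ((t - mat 1) ** (t - mat 1)))))
       \<in> O[at (mat 1)](\<lambda>t. norm (t - mat 1) ^ 3)"


section \<open>One step of the scheme for given parameter matrices\<close>

definition sw_w :: "(real^'n \<Rightarrow> real^'n) \<Rightarrow> real^'n^'n \<Rightarrow> real^'n \<Rightarrow> real^'n" where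
  "sw_w F \<beta> x = x + \<beta> *v F x"

definition sw_z1 :: "(real^'n \<Rightarrow> real^'n) \<Rightarrow> real^'n^'n \<Rightarrow> real^'n \<Rightarrow> real^'n" where
  "sw_z1 F \<beta> x = x - matrix_inv (divdiff F (sw_w F \<beta> x) x) *v F x"

definition sw_v ::
    "(real^'n \<Rightarrow> real^'n) \<Rightarrow> real^'n^'n \<Rightarrow> real^'n^'n \<Rightarrow> real^'n \<Rightarrow> real^'n" where
  "sw_v F \<beta> \<delta> x = sw_z1 F \<beta> x - \<delta> *v F (sw_z1 F \<beta> x)"

definition sw_t ::
    "(real^'n \<Rightarrow> real^'n) \<Rightarrow> real^'n^'n \<Rightarrow> real^'n^'n \<Rightarrow> real^'n \<Rightarrow> real^'n^'n" where
  "sw_t F \<beta> \<delta> x =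
     matrix_inv (divdiff F (sw_w F \<beta> x) x) ** divdiff F (sw_z1 F \<beta> x) (sw_v F \<beta> \<delta> x)"

definition sw_corr ::
    "(real^'n \<Rightarrow> real^'n) \<Rightarrow> (real^'n^'n \<Rightarrow> real^'n^'n) \<Rightarrow> real^'n^'n \<Rightarrow> real^'n^'n
      \<Rightarrow> real^'n \<Rightarrow> real^'n \<Rightarrow> real^'n" where
  "sw_corr F H \<beta> \<delta> x z =
     z - (H (sw_t F \<beta> \<delta> x) ** matrix_inv (divdiff F (sw_w F \<beta> x) x)) *v F z"

(* z_j is obtained from z_1 by j - 1 corrections, all with the same matrices;
   the result of the step is z_m. *)
definition sw_step ::
    "(real^'n \<Rightarrow> real^'n) \<Rightarrow> (real^'n^'n \<Rightarrow> real^'n^'n) \<Rightarrow> nat \<Rightarrow> real^'n^'n \<Rightarrow> real^'n^'n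
      \<Rightarrow> real^'n \<Rightarrow> real^'n" where
  "sw_step F H m \<beta> \<delta> x = (sw_corr F H \<beta> \<delta> x ^^ (m - 1)) (sw_z1 F \<beta> x)"

(* The divided differences are taken along segments in D, and the inverted matrix
   is nonsingular, so that no unspecified value enters the step. *)
definition sw_step_defined ::
    "(real^'n \<Rightarrow> real^'n) \<Rightarrow> (real^'n) set \<Rightarrow> real^'n^'n \<Rightarrow> real^'n^'n \<Rightarrow> real^'n \<Rightarrow> bool" where
  "sw_step_defined F D \<beta> \<delta> x \<longleftrightarrow>
     closed_segment x (sw_w F \<beta> x) \<subseteq> D \<and>
     invertible (divdiff F (sw_w F \<beta> x) x) \<and>
     closed_segment (sw_v F \<beta> \<delta> x) (sw_z1 F \<beta> x) \<subseteq> D"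


section \<open>The methods with memory\<close>

(* In the steps below, y is the previous iterate and x the current one. *)

definition swd_step ::
    "(real^'n \<Rightarrow> real^'n) \<Rightarrow> (real^'n^'n \<Rightarrow> real^'n^'n) \<Rightarrow> nat \<Rightarrow> real^'n \<Rightarrow> real^'n \<Rightarrow> real^'n" where
  "swd_step F H m y x =
     sw_step F H m (- matrix_inv (divdiff F x y)) (2 *\<^sub>R matrix_inv (divdiff F x y)) x"

definition swd_step_defined ::
    "(real^'n \<Rightarrow> real^'n) \<Rightarrow> (real^'n) set \<Rightarrow> real^'n \<Rightarrow> real^'n \<Rightarrow> bool" where
  "swd_step_defined F D y x \<longleftrightarrow>
     closed_segment y x \<subseteq> D \<and> invertible (divdiff F x y) \<and>
     sw_step_defined F D (- matrix_inv (divdiff F x y)) (2 *\<^sub>R matrix_inv (divdiff F x y)) x"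

definition kurchatov :: "(real^'n \<Rightarrow> real^'n) \<Rightarrow> real^'n \<Rightarrow> real^'n \<Rightarrow> real^'n^'n" where
  "kurchatov F x y = divdiff F (2 *\<^sub>R x - y) y"

definition swk_step ::
    "(real^'n \<Rightarrow> real^'n) \<Rightarrow> (real^'n^'n \<Rightarrow> real^'n^'n) \<Rightarrow> nat \<Rightarrow> real^'n \<Rightarrow> real^'n \<Rightarrow> real^'n" where
  "swk_step F H m y x =
     sw_step F H m (- matrix_inv (kurchatov F x y)) (2 *\<^sub>R matrix_inv (kurchatov F x y)) x"

definition swk_step_defined ::
    "(real^'n \<Rightarrow> real^'n) \<Rightarrow> (real^'n) set \<Rightarrow> real^'n \<Rightarrow> real^'n \<Rightarrow> bool" where
  "swk_step_defined F D y x \<longleftrightarrow>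
     closed_segment y (2 *\<^sub>R x - y) \<subseteq> D \<and> invertible (kurchatov F x y) \<and>
     sw_step_defined F D (- matrix_inv (kurchatov F x y)) (2 *\<^sub>R matrix_inv (kurchatov F x y)) x"

(* The index is shifted by one: the value at 0 is x^(-1), and the value at k + 1 is x^(k). *)
fun memory_iterates :: "('a \<Rightarrow> 'a \<Rightarrow> 'a) \<Rightarrow> 'a \<Rightarrow> 'a \<Rightarrow> nat \<Rightarrow> 'a" where
  "memory_iterates S xm1 x0 0 = xm1"
| "memory_iterates S xm1 x0 (Suc 0) = x0"
| "memory_iterates S xm1 x0 (Suc (Suc k)) =
     S (memory_iterates S xm1 x0 k) (memory_iterates S xm1 x0 (Suc k))"


section \<open>R-order of convergence\<close>

definition converges_with_order ::
    "(nat \<Rightarrow> 'a::real_normed_vector) \<Rightarrow> 'a \<Rightarrow> real \<Rightarrow> bool" where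
  "converges_with_order x \<alpha> p \<longleftrightarrow>
     x \<longlonglongrightarrow> \<alpha> \<and>
     (\<forall>q::real. 1 < q \<and> q < p \<longrightarrow>
        limsup (\<lambda>k. ereal (norm (x k - \<alpha>) powr (1 / q ^ k))) < 1)"

end

theory Submission
  imports Defs
begin

text \<open>
  Write \<open>e\<close> for the norm of the current error, \<open>\<Gamma>\<close> for the Jacobian of \<open>F\<close> at \<open>\<alpha>\<close>, \<open>B\<close> for the inverse
  of the divided difference kept in memory, and \<open>\<tau>\<close> for the size of \<open>mat 1 - B ** \<Gamma>\<close>. The proof
  has three ingredients.

  A divided difference equals \<open>\<Gamma> + L (midpoint - \<alpha>)\<close> up to second order, where \<open>L\<close> is the
  second derivative (\<open>divdiff_expansion\<close>). Hence \<open>\<tau>\<close> is of order \<open>e\<close> plus the previous error for the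
  secant memory, and of order \<open>e\<close> plus the square of the previous error for the Kurchatov memory,
  whose midpoint is the current iterate.

  Let \<open>\<theta> = \<tau> + e\<close> and \<open>\<rho> = \<theta>\<^sup>2 + e\<close>. The point \<open>w\<close> has an error of order \<open>\<theta> * e\<close>, hence the
  predictor \<open>z\<close> one of order \<open>\<theta> * e\<^sup>2\<close>. The point \<open>v\<close> is nearly the reflection of \<open>z\<close> in \<open>\<alpha>\<close>, so the divided difference \<open>V\<close>
  at \<open>z\<close> and \<open>v\<close> differs from \<open>\<Gamma>\<close> by a term of order \<open>\<theta>\<^sup>2 * e\<^sup>2\<close> (\<open>V_err\<close>). The conditions on the weight function say
  that \<open>H\<close> agrees with matrix inversion near the identity up to an error of third order, so \<open>H t\<close> times
  the inverse of \<open>W\<close>, the divided difference at \<open>w\<close> and \<open>x\<close>, is an inverse of \<open>V\<close> up to \<open>e ^ 3\<close>,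
  and thus an inverse of \<open>\<Gamma>\<close> up to \<open>\<rho> * e\<^sup>2\<close> (\<open>P_err\<close>). The first correction squares the error of
  the predictor, each further one multiplies the error by \<open>\<rho> * e\<^sup>2\<close>. Altogether the new error
  is of order \<open>e ^ (2 * m) * \<rho> ^ (m - 1)\<close> (\<open>iterated_corr_err\<close>).

  In terms of the previous error \<open>d\<close>, the quantity \<open>\<rho>\<close> is of order \<open>e + d ^ s\<close>, with \<open>s = 2\<close> for the secant
  and \<open>s = 4\<close> for the Kurchatov memory. The resulting recurrence of two steps has R-order at least
  the positive root of \<open>p\<^sup>2 = 2 * m * p + s * (m - 1)\<close> (\<open>two_step_recurrence_R_order\<close>), which
  is the claimed number.
\<close>

section \<open>R-order from a recurrence of two steps\<close>

lemma less_add_sqrt_imp_quadratic: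
  fixes q a b :: real
  assumes "q < a + sqrt (a\<^sup>2 + b)" and "0 \<le> q" and "0 \<le> a" and "0 < b"
  shows "q\<^sup>2 < 2 * a * q + b"
proof (cases "q \<le> a")
  case True
  have "q\<^sup>2 \<le> a * q"
    using True assms by (simp add: power2_eq_square mult_right_mono)
  also have "\<dots> < 2 * a * q + b"
    using assms by (simp add: add_nonneg_pos)
  finally show ?thesis .
next
  case False
  have "(q - a)\<^sup>2 < (sqrt (a\<^sup>2 + b))\<^sup>2"
    using False assms by (intro power_strict_mono) auto
  also have "\<dots> = a\<^sup>2 + b"
    using assms by (simp add: add_nonneg_nonneg)
  finally show ?thesis
    by (simp add: power2_eq_square algebra_simps)
qed

text \<open>
  Along \<open>e k \<approx> \<Lambda> powr (r ^ k)\<close> the recurrence compares the exponents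
  \<open>r\<^sup>2\<close> and \<open>2 * m * r + s * (m - 1)\<close>, as long as \<open>e k ^ s\<close> dominates the sum.
  The claimed order is the positive root of \<open>p\<^sup>2 = 2 * m * p + s * (m - 1)\<close>, so every smaller
  \<open>r\<close> leaves a positive surplus in the exponent, which pays for the constant \<open>C\<close>.
\<close>

lemma two_step_recurrence_R_order:
  fixes e :: "nat \<Rightarrow> real" and C q :: real and m s :: nat
  assumes m: "m \<ge> 2" and s: "1 \<le> s" "s \<le> 2 * m" and C: "C > 0"
    and nonneg: "\<And>k. e k \<ge> 0" and lim: "e \<longlonglongrightarrow> 0"
    and rec: "\<And>k. e (Suc (Suc k))
                \<le> C * (e (Suc k) ^ (2 * m) * (e (Suc k) + e k ^ s) ^ (m - 1))"
    and q: "1 < q" "q < real m + sqrt (real m ^ 2 + real s * (real m - 1))"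
  shows "limsup (\<lambda>k. ereal (e (Suc k) powr (1 / q ^ k))) < 1"
proof -
  define p where "p = real m + sqrt (real m ^ 2 + real s * (real m - 1))"
  have b: "real s * (real m - 1) > 0"
    using m s by simp
  have "real s < p"
  proof -
    have "real m = sqrt (real m ^ 2)"
      by simp
    also have "\<dots> < sqrt (real m ^ 2 + real s * (real m - 1))"
      using b by (subst real_sqrt_less_iff) simp
    finally have "2 * real m < p"
      by (simp add: p_def)
    then show ?thesis
      using s by linarith
  qed
  \<comment> \<open>Below the exponent \<open>s\<close> the term \<open>e (Suc k)\<close>, not \<open>e k ^ s\<close>, would dominate the sum.
      A larger exponent gives a stronger bound, so it is enough to treat exponents \<open>r \<ge> s\<close>.\<close>
  define r where "r = max q (real s)"
  have r: "q \<le> r" "real s \<le> r" "1 < r" "r < p"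
    using q \<open>real s < p\<close> by (auto simp: r_def p_def)
  define \<eta> where "\<eta> = 2 * real m * r + real s * (real m - 1) - r\<^sup>2"
  have \<eta>: "\<eta> > 0"
    using less_add_sqrt_imp_quadratic[of r "real m" "real s * (real m - 1)"] r b
    by (simp add: \<eta>_def p_def)
  define a where "a = 1 / (C * 2 ^ (m - 1))"
  have a: "a > 0"
    using C by (simp add: a_def)
  \<comment> \<open>The surplus \<open>\<eta>\<close> in the exponent absorbs the constant \<open>C\<close> as soon as the base is small.\<close>
  define \<Lambda> where "\<Lambda> = min (1 / 2) (a powr (1 / \<eta>))"
  have \<Lambda>: "0 < \<Lambda>" "\<Lambda> < 1"
    using a by (auto simp: \<Lambda>_def)
  have absorb: "\<Lambda> powr \<eta> \<le> a"
  proof -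
    have "\<Lambda> powr \<eta> \<le> (a powr (1 / \<eta>)) powr \<eta>"
      using \<Lambda> \<eta> by (intro powr_mono2) (auto simp: \<Lambda>_def)
    then show ?thesis
      using \<eta> a by (simp add: powr_powr)
  qed
  obtain N where N: "\<And>n. n \<ge> N \<Longrightarrow> e n < \<Lambda> powr r"
    using order_tendstoD(2)[OF lim, of "\<Lambda> powr r"] \<Lambda> by (auto simp: eventually_sequentially)
  have decay: "e (N + j) \<le> \<Lambda> powr (r ^ j) \<and> e (N + Suc j) \<le> \<Lambda> powr (r ^ Suc j)" for j
  proof (induction j)
    case 0
    have "e N \<le> \<Lambda> powr r"
      using N[of N] by simp
    also have "\<dots> \<le> \<Lambda> powr 1"
      using \<Lambda> r by (intro powr_mono') auto
    finally show ?case
      using N[of "Suc N"] \<Lambda> by simp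
  next
    case (Suc j)
    define u where "u = \<Lambda> powr (r ^ j)"
    have u: "0 < u" "u \<le> \<Lambda>"
    proof -
      have "u \<le> \<Lambda> powr 1"
        unfolding u_def using \<Lambda> r by (intro powr_mono') auto
      then show "u \<le> \<Lambda>" using \<Lambda> by simp
    qed (use \<Lambda> in \<open>simp add: u_def\<close>)
    have u_powr: "\<Lambda> powr (r ^ Suc j) = u powr r" "\<Lambda> powr (r ^ Suc (Suc j)) = u powr (r\<^sup>2)"
      by (simp_all add: u_def powr_powr power2_eq_square mult_ac)
    have e0: "e (N + j) \<le> u" and e1: "e (N + Suc j) \<le> u powr r"
      using Suc.IH u_powr by (auto simp: u_def)
    have "e (N + j) ^ s \<le> u powr real s"
      using power_mono[OF e0 nonneg, of s] u by (simp add: powr_realpow)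
    moreover have "u powr r \<le> u powr real s"
      using u \<Lambda> r by (intro powr_mono') auto
    ultimately have sum: "e (N + Suc j) + e (N + j) ^ s \<le> 2 * u powr real s"
      using e1 by linarith
    have "e (N + Suc (Suc j))
        \<le> C * (e (N + Suc j) ^ (2 * m) * (e (N + Suc j) + e (N + j) ^ s) ^ (m - 1))"
      using rec[of "N + j"] by simp
    also have "\<dots> \<le> C * ((u powr r) ^ (2 * m) * (2 * u powr real s) ^ (m - 1))"
      using C e1 sum nonneg
      by (intro mult_left_mono mult_mono power_mono) (auto intro!: add_nonneg_nonneg)
    also have "\<dots> = (1 / a) * (u powr (2 * real m * r) * u powr (real s * (real m - 1)))"
      using u m C
      by (simp add: a_def power_mult_distrib powr_realpow[symmetric] powr_powr of_nat_diff mult_ac)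
    also have "\<dots> = (1 / a) * (u powr \<eta> * u powr (r\<^sup>2))"
      unfolding powr_add[symmetric] by (simp add: \<eta>_def)
    also have "\<dots> \<le> (1 / a) * (a * u powr (r\<^sup>2))"
    proof -
      have "u powr \<eta> \<le> \<Lambda> powr \<eta>"
        using u \<eta> by (intro powr_mono2) auto
      then show ?thesis
        using absorb a by (intro mult_left_mono mult_right_mono) auto
    qed
    finally show ?case
      using Suc.IH u_powr a by simp
  qed
  define \<mu> where "\<mu> = \<Lambda> powr (r / r ^ N)"
  have \<mu>: "0 < \<mu>" "\<mu> < 1"
  proof -
    have "\<Lambda> powr (r / r ^ N) < \<Lambda> powr 0"
      using \<Lambda> r by (intro powr_less_mono') auto
    then show "\<mu> < 1" using \<Lambda> by (simp add: \<mu>_def)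
  qed (use \<Lambda> in \<open>simp add: \<mu>_def\<close>)
  have "e (Suc k) powr (1 / q ^ k) \<le> \<mu>" if "k \<ge> N" for k
  proof -
    have "Suc k = N + (Suc k - N)"
      using that by simp
    then have "e (Suc k) \<le> \<Lambda> powr (r ^ (Suc k - N))"
      using decay[of "Suc k - N"] by metis
    also have "r ^ (Suc k - N) = r ^ Suc k / r ^ N"
      using that r by (subst power_diff) auto
    also have "\<Lambda> powr (r ^ Suc k / r ^ N) = \<mu> powr (r ^ k)"
      by (simp add: \<mu>_def powr_powr mult_ac)
    finally have "e (Suc k) powr (1 / q ^ k) \<le> (\<mu> powr (r ^ k)) powr (1 / q ^ k)"
      using q nonneg by (intro powr_mono2) auto
    also have "\<dots> = \<mu> powr ((r / q) ^ k)"
      by (simp add: powr_powr power_divide)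
    also have "\<dots> \<le> \<mu> powr 1"
      using \<mu> r q by (intro powr_mono') (auto intro!: one_le_power)
    finally show ?thesis
      using \<mu> by simp
  qed
  then have "limsup (\<lambda>k. ereal (e (Suc k) powr (1 / q ^ k))) \<le> ereal \<mu>"
    by (intro Limsup_bounded) (auto simp: eventually_sequentially)
  also have "\<dots> < 1"
    using \<mu> by simp
  finally show ?thesis .
qed

text \<open>
  The hypothesis bounds one step near \<open>(\<alpha>, \<alpha>)\<close> only. It suffices because the power
  \<open>norm (x - \<alpha>) ^ (2 * m)\<close> makes the iteration contract on a small ball, so that the iterates
  never leave the region in which the bound holds.
\<close>

lemma memory_method_local_R_order:
  fixes S :: "'a::real_normed_vector \<Rightarrow> 'a \<Rightarrow> 'a" and \<alpha> :: 'a and m s :: nat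
  assumes m: "m \<ge> 2" and s: "1 \<le> s" "s \<le> 2 * m"
    and P: "\<forall>\<^sub>F (y, x) in nhds (\<alpha>, \<alpha>). P y x"
    and bound: "(\<lambda>(y, x). norm (S y x - \<alpha>)) \<in> O[nhds (\<alpha>, \<alpha>)](\<lambda>(y, x).
        norm (x - \<alpha>) ^ (2 * m) * (norm (x - \<alpha>) + norm (y - \<alpha>) ^ s) ^ (m - 1))"
  shows "\<exists>\<epsilon>>0. \<forall>xm1 x0. dist xm1 \<alpha> < \<epsilon> \<and> dist x0 \<alpha> < \<epsilon> \<longrightarrow>
           (let X = memory_iterates S xm1 x0
            in (\<forall>k. P (X k) (X (Suc k))) \<and>
               converges_with_order (\<lambda>k. X (Suc k)) \<alpha>
                 (real m + sqrt (real m ^ 2 + real s * (real m - 1))))"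
proof -
  from bound obtain C where C: "C > 0"
    and "\<forall>\<^sub>F z in nhds (\<alpha>, \<alpha>). norm (case z of (y, x) \<Rightarrow> norm (S y x - \<alpha>))
       \<le> C * norm (case z of (y, x) \<Rightarrow> norm (x - \<alpha>) ^ (2 * m)
                          * (norm (x - \<alpha>) + norm (y - \<alpha>) ^ s) ^ (m - 1))"
    by (elim landau_o.bigE)
  from eventually_conj[OF P this(2)] obtain A B where
    "eventually A (nhds \<alpha>)" "eventually B (nhds \<alpha>)"
    and AB: "\<And>y x. A y \<Longrightarrow> B x \<Longrightarrow> P y x \<and> norm (S y x - \<alpha>)
       \<le> C * (norm (x - \<alpha>) ^ (2 * m) * (norm (x - \<alpha>) + norm (y - \<alpha>) ^ s) ^ (m - 1))"
    unfolding nhds_prod eventually_prod_filter by auto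
  then have "eventually (\<lambda>x. A x \<and> B x) (nhds \<alpha>)"
    by (intro eventually_conj)
  then obtain d where d: "d > 0" and near: "\<And>x. dist x \<alpha> < d \<Longrightarrow> A x \<and> B x"
    unfolding eventually_nhds_metric by blast
  define \<epsilon> where "\<epsilon> = Min {d, 1, 1 / (C * 2 ^ m)}"
  have \<epsilon>: "0 < \<epsilon>" "\<epsilon> \<le> d" "\<epsilon> \<le> 1" "\<epsilon> \<le> 1 / (C * 2 ^ m)"
    using C d by (simp_all add: \<epsilon>_def)
  \<comment> \<open>On the ball of radius \<open>\<epsilon>\<close> a step at least halves the error.\<close>
  have halve: "C * (a ^ (2 * m) * (a + b ^ s) ^ (m - 1)) \<le> a / 2"
    if a: "0 \<le> a" "a < \<epsilon>" and b: "0 \<le> b" "b < \<epsilon>" for a b :: real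
  proof -
    have "a ^ (2 * m) \<le> a ^ 2"
      using a \<epsilon> m by (intro power_decreasing) auto
    also have "\<dots> \<le> a * \<epsilon>"
      using a by (simp add: power2_eq_square mult_left_mono)
    finally have 1: "a ^ (2 * m) \<le> a * \<epsilon>" .
    have "b ^ s \<le> 1"
      using b \<epsilon> by (intro power_le_one) auto
    then have 2: "(a + b ^ s) ^ (m - 1) \<le> 2 ^ (m - 1)"
      using a b \<epsilon> by (intro power_mono add_nonneg_nonneg) auto
    have "C * (a ^ (2 * m) * (a + b ^ s) ^ (m - 1)) \<le> C * ((a * \<epsilon>) * 2 ^ (m - 1))"
      using C 1 2 a b \<epsilon> by (intro mult_left_mono mult_mono) auto
    also have "\<dots> \<le> C * ((a * (1 / (C * 2 ^ m))) * 2 ^ (m - 1))"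
      using C a \<epsilon> by (intro mult_left_mono mult_right_mono) auto
    also have "\<dots> = a / 2"
      using C m by (cases m) (auto simp: field_simps)
    finally show ?thesis .
  qed
  have "(\<forall>k. P (X k) (X (Suc k))) \<and>
          converges_with_order (\<lambda>k. X (Suc k)) \<alpha>
             (real m + sqrt (real m ^ 2 + real s * (real m - 1)))"
    if start: "dist xm1 \<alpha> < \<epsilon>" "dist x0 \<alpha> < \<epsilon>" and X: "X = memory_iterates S xm1 x0"
    for xm1 x0 X
  proof -
    define e where "e k = norm (X k - \<alpha>)" for k
    have e_nonneg: "e k \<ge> 0" for k
      by (simp add: e_def)
    have step: "P (X k) (X (Suc k)) \<and> e (Suc (Suc k))
        \<le> C * (e (Suc k) ^ (2 * m) * (e (Suc k) + e k ^ s) ^ (m - 1))"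
      if "e k < \<epsilon>" "e (Suc k) < \<epsilon>" for k
    proof -
      have "A (X k)" "B (X (Suc k))"
        using near[of "X k"] near[of "X (Suc k)"] that \<epsilon> by (auto simp: e_def dist_norm)
      from AB[OF this] show ?thesis
        by (simp add: e_def X)
    qed
    have small: "e k < \<epsilon> \<and> e (Suc k) < \<epsilon> \<and> e (Suc k) \<le> \<epsilon> * (1 / 2) ^ k" for k
    proof (induction k)
      case 0
      then show ?case
        using start by (simp add: e_def X dist_norm)
    next
      case (Suc k)
      then have "e (Suc (Suc k)) \<le> e (Suc k) / 2"
        using step[of k] halve[of "e (Suc k)" "e k"] e_nonneg by fastforce
      then show ?case
        using Suc e_nonneg[of "Suc k"] by auto
    qed
    have rec: "e (Suc (Suc k)) \<le> C * (e (Suc k) ^ (2 * m) * (e (Suc k) + e k ^ s) ^ (m - 1))"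
      and defd: "P (X k) (X (Suc k))" for k
      using step[of k] small[of k] by auto
    have lim': "(\<lambda>k. e (Suc k)) \<longlonglongrightarrow> 0"
    proof (rule tendsto_sandwich[OF _ _ tendsto_const])
      show "(\<lambda>k. \<epsilon> * (1 / 2) ^ k) \<longlonglongrightarrow> 0"
        by (auto intro!: tendsto_mult_right_zero LIMSEQ_power_zero)
    qed (use small e_nonneg in auto)
    then have lim: "e \<longlonglongrightarrow> 0"
      by (rule LIMSEQ_imp_Suc)
    have "(\<lambda>k. X (Suc k)) \<longlonglongrightarrow> \<alpha>"
      using lim' unfolding e_def by (simp add: LIM_zero_iff tendsto_norm_zero_iff)
    moreover have "limsup (\<lambda>k. ereal (norm (X (Suc k) - \<alpha>) powr (1 / q ^ k))) < 1"
      if "1 < q" "q < real m + sqrt (real m ^ 2 + real s * (real m - 1))" for q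
      using two_step_recurrence_R_order[OF m s C e_nonneg lim rec that] by (simp add: e_def)
    ultimately show ?thesis
      using defd by (simp add: converges_with_order_def)
  qed
  then show ?thesis
    using \<epsilon>(1) unfolding Let_def by blast
qed

section \<open>Orders of magnitude of matrices\<close>

lemma norm_matrix_vector_mult_le:
  fixes A :: "real^'n^'m"
  shows "norm (A *v x) \<le> norm A * norm x"
proof -
  have "norm (A *v x) \<le> L2_set (\<lambda>i. norm (A $ i) * norm x) UNIV"
    unfolding norm_vec_def[of "A *v x"]
    by (intro L2_set_mono) (simp_all add: matrix_vector_mul_component Cauchy_Schwarz_ineq2)
  also have "\<dots> = norm A * norm x"
    by (simp add: norm_vec_def[of A] L2_set_left_distrib)
  finally show ?thesis .
qed

lemma norm_transpose:
  fixes A :: "real^'n^'m"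
  shows "norm (transpose A) = norm A"
proof -
  have "(norm (transpose A))\<^sup>2 = (\<Sum>i\<in>UNIV. \<Sum>j\<in>UNIV. (A $ j $ i)\<^sup>2)"
    by (simp add: norm_vec_def L2_set_def transpose_def sum_nonneg)
  also have "\<dots> = (\<Sum>j\<in>UNIV. \<Sum>i\<in>UNIV. (A $ j $ i)\<^sup>2)"
    by (rule sum.swap)
  also have "\<dots> = (norm A)\<^sup>2"
    by (simp add: norm_vec_def L2_set_def sum_nonneg)
  finally show ?thesis
    by simp
qed

text \<open>
  The norm of the type of matrices is the Frobenius norm. Each row of \<open>A ** B\<close> is a row of \<open>A\<close>
  multiplied by \<open>B\<close>, which reduces submultiplicativity to the bound for a matrix and a vector.
\<close>

lemma norm_matrix_matrix_mult_le:
  fixes A :: "real^'n^'m" and B :: "real^'p^'n"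
  shows "norm (A ** B) \<le> norm A * norm B"
proof -
  have row: "(A ** B) $ i = transpose B *v (A $ i)" for i
    by (simp add: matrix_matrix_mult_def vector_matrix_mult_def vec_eq_iff mult.commute)
  have "norm (A ** B) \<le> L2_set (\<lambda>i. norm (A $ i) * norm B) UNIV"
    unfolding norm_vec_def[of "A ** B"] row
    by (intro L2_set_mono order_trans[OF norm_matrix_vector_mult_le])
      (simp_all add: norm_transpose mult.commute del: transpose_matrix_vector)
  also have "\<dots> = norm A * norm B"
    by (simp add: norm_vec_def[of A] L2_set_left_distrib)
  finally show ?thesis .
qed

lemma matrix_diff_ldistrib: "A ** (B - C) = A ** B - A ** (C :: real^'p^'n)"
  by (vector matrix_matrix_mult_def sum_subtractf[symmetric] field_simps)

lemma matrix_diff_rdistrib: "(A - B) ** C = A ** C - (B :: real^'p^'n) ** C"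
  by (vector matrix_matrix_mult_def sum_subtractf[symmetric] field_simps)

lemma matrix_add_rdistrib: "(A + B) ** C = A ** C + (B :: real^'p^'n) ** C"
  by (vector matrix_matrix_mult_def sum.distrib[symmetric] field_simps)

lemma matrix_inv_inverse:
  assumes "invertible A"
  shows "A ** matrix_inv A = mat 1" and "matrix_inv A ** A = mat 1"
  using someI_ex[OF assms[unfolded invertible_def]] by (simp_all add: matrix_inv_def)

text \<open>
  The error analysis is a calculation with orders of magnitude of vectors and matrices. The Landau
  symbols are for functions into a field, so they are applied to norms.
\<close>

abbreviation norm_bigo :: "'i filter \<Rightarrow> ('i \<Rightarrow> 'a::real_normed_vector) \<Rightarrow> ('i \<Rightarrow> real) \<Rightarrow> bool"
  where "norm_bigo G f g \<equiv> (\<lambda>i. norm (f i)) \<in> O[G](g)"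

lemma norm_bigo_norm_le:
  assumes "norm_bigo G g h" and "\<forall>\<^sub>F i in G. norm (f i) \<le> norm (g i)"
  shows "norm_bigo G f h"
  by (rule landau_o.big_trans[OF landau_o.big_mono assms(1)]) (use assms(2) in auto)

lemma norm_bigo_cong:
  assumes "norm_bigo G g h" and "\<forall>\<^sub>F i in G. f i = g i"
  shows "norm_bigo G f h"
  by (rule norm_bigo_norm_le[OF assms(1)]) (use assms(2) in eventually_elim, simp)

lemma norm_bigo_add:
  assumes "norm_bigo G f h" and "norm_bigo G g h"
  shows "norm_bigo G (\<lambda>i. f i + g i) h"
  by (rule landau_o.big_trans[OF landau_o.big_mono sum_in_bigo(1)[OF assms]])
    (simp add: norm_triangle_ineq)

lemma norm_bigo_diff:
  assumes "norm_bigo G f h" and "norm_bigo G g h"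
  shows "norm_bigo G (\<lambda>i. f i - g i) h"
  using norm_bigo_add[of f G h "\<lambda>i. - g i"] assms by simp

lemma norm_bigo_matrix_mult:
  fixes A :: "'i \<Rightarrow> real^'n^'m" and B :: "'i \<Rightarrow> real^'p^'n"
  assumes "norm_bigo G A g" and "norm_bigo G B h"
  shows "norm_bigo G (\<lambda>i. A i ** B i) (\<lambda>i. g i * h i)"
  by (rule landau_o.big_trans[OF landau_o.big_mono landau_o.big_mult[OF assms]])
    (simp add: norm_matrix_matrix_mult_le)

lemma norm_bigo_matrix_vector_mult:
  fixes A :: "'i \<Rightarrow> real^'n^'m"
  assumes "norm_bigo G A g" and "norm_bigo G f h"
  shows "norm_bigo G (\<lambda>i. A i *v f i) (\<lambda>i. g i * h i)"
  by (rule landau_o.big_trans[OF landau_o.big_mono landau_o.big_mult[OF assms]])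
    (simp add: norm_matrix_vector_mult_le)

lemma norm_bigo_bounded_linear:
  assumes L: "bounded_linear L" and f: "norm_bigo G f g"
  shows "norm_bigo G (\<lambda>i. L (f i)) g"
proof -
  obtain k where k: "k > 0" "\<And>v. norm (L v) \<le> norm v * k"
    using bounded_linear.pos_bounded[OF L] by blast
  have "norm_bigo G (\<lambda>i. L (f i)) (\<lambda>i. norm (f i))"
    by (rule bigoI[where c = k]) (use k in \<open>simp add: mult.commute\<close>)
  then show ?thesis
    using f by (rule landau_o.big_trans)
qed

lemma bigo_mult_bounded:
  fixes f g :: "'i \<Rightarrow> real"
  assumes "f \<in> O[G](\<lambda>_. 1)"
  shows "(\<lambda>i. f i * g i) \<in> O[G](g)"
  using landau_o.big_mult[OF assms landau_o.big_refl, of g] by simp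

lemma tendsto_zero_imp_bigo_1:
  fixes g :: "'i \<Rightarrow> real"
  assumes "(g \<longlongrightarrow> 0) G"
  shows "g \<in> O[G](\<lambda>_. 1)"
  by (rule bigoI_tendsto[where c = 0]) (use assms in auto)

lemma tendsto_imp_norm_bigo_1:
  assumes "(f \<longlongrightarrow> a) G"
  shows "norm_bigo G f (\<lambda>_. 1)"
  by (rule bigoI_tendsto[where c = "norm a"]) (use tendsto_norm[OF assms] in auto)

lemma norm_bigo_diff_imp_tendsto:
  assumes "norm_bigo G (\<lambda>i. f i - a) g" and "(g \<longlongrightarrow> 0) G"
  shows "(f \<longlongrightarrow> a) G"
proof -
  obtain c where "\<forall>\<^sub>F i in G. norm (norm (f i - a)) \<le> c * norm (g i)"
    using assms(1) by (elim landau_o.bigE)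
  then have "\<forall>\<^sub>F i in G. norm (f i - a) \<le> c * norm (g i)"
    by simp
  moreover have "((\<lambda>i. c * norm (g i)) \<longlongrightarrow> 0) G"
    by (intro tendsto_mult_right_zero tendsto_norm_zero assms)
  ultimately have "((\<lambda>i. f i - a) \<longlongrightarrow> 0) G"
    by (rule Lim_null_comparison)
  then show ?thesis
    by (simp add: LIM_zero_iff)
qed

lemma bigo_imp_tendsto_0:
  fixes f g :: "'i \<Rightarrow> real"
  assumes "f \<in> O[G](g)" and "(g \<longlongrightarrow> 0) G"
  shows "(f \<longlongrightarrow> 0) G"
  using norm_bigo_diff_imp_tendsto[where a = "0::real" and f = f] assms by simp

text \<open>
  Boundedness of the inverses is all that the error analysis needs, and it follows without
  determinants: \<open>matrix_inv \<Gamma> ** M i\<close> is the identity minus a matrix of norm below \<open>1 / 2\<close>, so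
  it keeps at least half the length of every vector and is injective.
\<close>

lemma matrix_inv_bounded_near_invertible:
  fixes M :: "'i \<Rightarrow> real^'n^'n"
  assumes \<Gamma>: "invertible \<Gamma>" and M: "(M \<longlongrightarrow> \<Gamma>) G"
  shows "\<forall>\<^sub>F i in G. invertible (M i)"
    and "norm_bigo G (\<lambda>i. matrix_inv (M i)) (\<lambda>_. 1)"
proof -
  define E where "E i = matrix_inv \<Gamma> ** (\<Gamma> - M i)" for i
  have "((\<lambda>i. norm (matrix_inv \<Gamma>) * norm (\<Gamma> - M i)) \<longlongrightarrow> norm (matrix_inv \<Gamma>) * norm (\<Gamma> - \<Gamma>)) G"
    by (intro tendsto_intros M)
  then have "\<forall>\<^sub>F i in G. norm (matrix_inv \<Gamma>) * norm (\<Gamma> - M i) < 1 / 2"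
    by (rule order_tendstoD) simp
  then have small: "\<forall>\<^sub>F i in G. norm (E i) < 1 / 2"
    unfolding E_def by eventually_elim (rule le_less_trans[OF norm_matrix_matrix_mult_le])
  have E: "matrix_inv \<Gamma> ** M i = mat 1 - E i" for i
    by (simp add: E_def matrix_diff_ldistrib matrix_inv_inverse[OF \<Gamma>])
  have inv: "invertible (M i)" if "norm (E i) < 1 / 2" for i
  proof -
    have "u = 0" if "M i *v u = 0" for u
    proof -
      have "(mat 1 - E i) *v u = 0"
        unfolding E[symmetric] matrix_vector_mul_assoc[symmetric] that by simp
      then have "u = E i *v u"
        by (simp add: matrix_vector_mult_diff_rdistrib)
      then have "norm u \<le> norm (E i) * norm u"
        using norm_matrix_vector_mult_le by metis
      also have "\<dots> \<le> 1 / 2 * norm u"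
        using \<open>norm (E i) < 1 / 2\<close> by (intro mult_right_mono) auto
      finally show ?thesis
        by simp
    qed
    then have "inj ((*v) (M i))"
      by (simp add: linear_injective_0)
    then show ?thesis
      by (simp add: invertible_left_inverse matrix_left_invertible_injective)
  qed
  show "\<forall>\<^sub>F i in G. invertible (M i)"
    using small by eventually_elim (rule inv)
  have "norm (matrix_inv (M i)) \<le> 2 * norm (matrix_inv \<Gamma>)" if i: "norm (E i) < 1 / 2" for i
  proof -
    have "(matrix_inv \<Gamma> ** M i) ** matrix_inv (M i) = matrix_inv \<Gamma>"
      by (simp add: matrix_mul_assoc[symmetric] matrix_inv_inverse[OF inv[OF i]])
    then have "matrix_inv (M i) = matrix_inv \<Gamma> + E i ** matrix_inv (M i)"
      unfolding E by (simp add: matrix_diff_rdistrib algebra_simps)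
    then have "norm (matrix_inv (M i)) \<le> norm (matrix_inv \<Gamma>) + norm (E i ** matrix_inv (M i))"
      by (metis norm_triangle_ineq)
    also have "norm (E i ** matrix_inv (M i)) \<le> norm (E i) * norm (matrix_inv (M i))"
      by (rule norm_matrix_matrix_mult_le)
    also have "\<dots> \<le> 1 / 2 * norm (matrix_inv (M i))"
      using i by (intro mult_right_mono) auto
    finally show ?thesis
      by simp
  qed
  then show "norm_bigo G (\<lambda>i. matrix_inv (M i)) (\<lambda>_. 1)"
    using small by (intro bigoI[where c = "2 * norm (matrix_inv \<Gamma>)"]) (auto elim: eventually_mono)
qed

section \<open>Second-order expansion of divided differences\<close>

lemma differentiable_imp_bigo_norm:
  fixes f :: "'a::real_normed_vector \<Rightarrow> 'b::real_normed_vector"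
  assumes "f differentiable (at \<alpha>)"
  shows "(\<lambda>x. norm (f x - f \<alpha>)) \<in> O[nhds \<alpha>](\<lambda>x. norm (x - \<alpha>))"
proof -
  obtain f' where "(f has_derivative f') (at \<alpha>)"
    using assms by (auto simp: differentiable_def)
  then have f': "bounded_linear f'"
    and alt: "\<forall>e>0. \<exists>d>0. \<forall>y. norm (y - \<alpha>) < d \<longrightarrow> norm (f y - f \<alpha> - f' (y - \<alpha>)) \<le> e * norm (y - \<alpha>)"
    by (simp_all add: has_derivative_at_alt)
  obtain d where d: "d > 0" "\<And>y. norm (y - \<alpha>) < d \<Longrightarrow> norm (f y - f \<alpha> - f' (y - \<alpha>)) \<le> 1 * norm (y - \<alpha>)"
    using alt zero_less_one by blast
  obtain K where K: "\<And>x. norm (f' x) \<le> norm x * K"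
    using bounded_linear.bounded[OF f'] by blast
  have "\<forall>\<^sub>F y in nhds \<alpha>. norm (norm (f y - f \<alpha>)) \<le> (1 + \<bar>K\<bar>) * norm (norm (y - \<alpha>))"
  proof (rule eventually_nhds_metric[THEN iffD2], intro exI conjI allI impI)
    fix y assume "dist y \<alpha> < d"
    then have "norm (f y - f \<alpha> - f' (y - \<alpha>)) \<le> norm (y - \<alpha>)"
      using d by (simp add: dist_norm)
    moreover have "norm (f' (y - \<alpha>)) \<le> norm (y - \<alpha>) * \<bar>K\<bar>"
      using K[of "y - \<alpha>"] by (meson abs_ge_self mult_left_mono norm_ge_zero order_trans)
    ultimately show "norm (norm (f y - f \<alpha>)) \<le> (1 + \<bar>K\<bar>) * norm (norm (y - \<alpha>))"
      using norm_triangle_ineq[of "f y - f \<alpha> - f' (y - \<alpha>)" "f' (y - \<alpha>)"]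
      by (simp add: algebra_simps)
  qed (use d in simp)
  then show ?thesis
    by (rule bigoI)
qed

text \<open>
  It is the mean value inequality for \<open>g\<close> minus its linear part at \<open>\<alpha>\<close>. The derivative of this
  difference is of the order of the distance to \<open>\<alpha>\<close>, because the directional derivatives of \<open>g\<close>
  are themselves differentiable at \<open>\<alpha>\<close>.
\<close>

lemma Ck_on_2_linearization_error:
  fixes g :: "'a::euclidean_space \<Rightarrow> 'b::real_normed_vector"
  assumes D: "open D" "\<alpha> \<in> D" and g: "Ck_on 2 D g"
  shows "(\<lambda>u. norm (g u - g \<alpha> - frechet_derivative g (at \<alpha>) (u - \<alpha>)))
           \<in> O[nhds \<alpha>](\<lambda>u. norm (u - \<alpha>) ^ 2)"
proof -
  let ?g' = "\<lambda>x. frechet_derivative g (at x)"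
  have diff: "\<And>x. x \<in> D \<Longrightarrow> g differentiable (at x)"
    and diff': "\<And>v x. x \<in> D \<Longrightarrow> (\<lambda>x. ?g' x v) differentiable (at x)"
    using g by (auto simp: numeral_2_eq_2)
  have "(\<lambda>x. \<Sum>b\<in>Basis. norm (?g' x b - ?g' \<alpha> b)) \<in> O[nhds \<alpha>](\<lambda>x. norm (x - \<alpha>))"
    by (intro big_sum_in_bigo differentiable_imp_bigo_norm diff' D)
  then obtain c where c: "c > 0"
    and ev: "\<forall>\<^sub>F x in nhds \<alpha>. norm (\<Sum>b\<in>Basis. norm (?g' x b - ?g' \<alpha> b)) \<le> c * norm (norm (x - \<alpha>))"
    by (elim landau_o.bigE)
  from ev have "\<forall>\<^sub>F x in nhds \<alpha>. x \<in> D \<and> (\<Sum>b\<in>Basis. norm (?g' x b - ?g' \<alpha> b)) \<le> c * norm (x - \<alpha>)"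
    using eventually_nhds_in_open[OF D] by eventually_elim auto
  then obtain d where d: "d > 0" and near: "\<And>x. dist x \<alpha> < d \<Longrightarrow>
      x \<in> D \<and> (\<Sum>b\<in>Basis. norm (?g' x b - ?g' \<alpha> b)) \<le> c * norm (x - \<alpha>)"
    unfolding eventually_nhds_metric by blast
  have "norm (g u - g \<alpha> - ?g' \<alpha> (u - \<alpha>)) \<le> c * norm (u - \<alpha>) ^ 2" if u: "dist u \<alpha> < d" for u
  proof -
    let ?S = "closed_segment \<alpha> u"
    have S: "dist x \<alpha> \<le> dist u \<alpha>" if "x \<in> ?S" for x
      using segment_bound1[OF that] by (simp add: dist_norm)
    have lin: "linear (?g' x)" if "x \<in> D" for x
      using diff[OF that] by (rule linear_frechet_derivative)
    have expand: "?g' x v = (\<Sum>b\<in>Basis. (v \<bullet> b) *\<^sub>R ?g' x b)" if "x \<in> D" for x v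
    proof -
      have "?g' x v = ?g' x (\<Sum>b\<in>Basis. (v \<bullet> b) *\<^sub>R b)"
        by (simp only: euclidean_representation)
      also have "\<dots> = (\<Sum>b\<in>Basis. ?g' x ((v \<bullet> b) *\<^sub>R b))"
        by (rule linear_sum[OF lin[OF that]])
      finally show ?thesis
        by (simp only: linear_scale[OF lin[OF that]])
    qed
    have "norm ((g u - ?g' \<alpha> u) - (g \<alpha> - ?g' \<alpha> \<alpha>)) \<le> (c * norm (u - \<alpha>)) * norm (u - \<alpha>)"
    proof (rule differentiable_bound[where S = ?S and f' = "\<lambda>x v. ?g' x v - ?g' \<alpha> v"])
      fix x assume x: "x \<in> ?S"
      then have "dist x \<alpha> < d"
        using S[OF x] u by simp
      then have xD: "x \<in> D" and bd: "(\<Sum>b\<in>Basis. norm (?g' x b - ?g' \<alpha> b)) \<le> c * norm (x - \<alpha>)"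
        using near by auto
      have "(g has_derivative ?g' x) (at x)"
        using diff[OF xD] by (simp add: frechet_derivative_works)
      moreover have "(?g' \<alpha> has_derivative ?g' \<alpha>) (at x)"
        using lin[OF D(2)] by (simp add: bounded_linear_imp_has_derivative linear_conv_bounded_linear)
      ultimately show "((\<lambda>x. g x - ?g' \<alpha> x) has_derivative (\<lambda>v. ?g' x v - ?g' \<alpha> v)) (at x within ?S)"
        by (rule has_derivative_at_withinI[OF has_derivative_diff])
      have "norm (?g' x v - ?g' \<alpha> v) \<le> (c * norm (u - \<alpha>)) * norm v" for v
      proof -
        have "?g' x v - ?g' \<alpha> v = (\<Sum>b\<in>Basis. (v \<bullet> b) *\<^sub>R (?g' x b - ?g' \<alpha> b))"
          using expand[OF xD, of v] expand[OF D(2), of v]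
          by (simp add: scaleR_diff_right sum_subtractf)
        also have "norm \<dots> \<le> (\<Sum>b\<in>Basis. norm v * norm (?g' x b - ?g' \<alpha> b))"
          by (intro sum_norm_le) (auto intro!: mult_right_mono Basis_le_norm)
        also have "\<dots> \<le> norm v * (c * norm (x - \<alpha>))"
          unfolding sum_distrib_left[symmetric] by (intro mult_left_mono bd) auto
        also have "\<dots> \<le> norm v * (c * norm (u - \<alpha>))"
          using S[OF x] c by (intro mult_left_mono) (auto simp: dist_norm)
        finally show ?thesis
          by (simp add: mult_ac)
      qed
      then show "onorm (\<lambda>v. ?g' x v - ?g' \<alpha> v) \<le> c * norm (u - \<alpha>)"
        by (intro onorm_le)
    qed auto
    then show ?thesis
      by (simp add: power2_eq_square linear_diff[OF lin[OF D(2)]] algebra_simps)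
  qed
  then have "\<forall>\<^sub>F u in nhds \<alpha>. norm (norm (g u - g \<alpha> - ?g' \<alpha> (u - \<alpha>))) \<le> c * norm (norm (u - \<alpha>) ^ 2)"
    unfolding eventually_nhds_metric using d by auto
  then show ?thesis
    by (rule bigoI)
qed

lemma Ck_on_2_differentiable:
  "Ck_on 2 D g \<Longrightarrow> x \<in> D \<Longrightarrow> g differentiable (at x)"
  by (simp add: numeral_2_eq_2)

lemma Ck_on_3_columns:
  assumes "Ck_on 3 D F"
  shows "\<And>x. x \<in> D \<Longrightarrow> F differentiable (at x)"
    and "\<And>v. Ck_on 2 D (\<lambda>x. frechet_derivative F (at x) v)"
  using assms by (auto simp: numeral_3_eq_3 numeral_2_eq_2)

lemma norm_matrix_le_sum:
  fixes A :: "real^'n^'m"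
  shows "norm A \<le> (\<Sum>i\<in>UNIV. \<Sum>j\<in>UNIV. \<bar>A $ i $ j\<bar>)"
proof -
  have "norm A \<le> (\<Sum>i\<in>UNIV. norm (A $ i))"
    unfolding norm_vec_def by (intro L2_set_le_sum) auto
  also have "\<dots> \<le> (\<Sum>i\<in>UNIV. \<Sum>j\<in>UNIV. \<bar>A $ i $ j\<bar>)"
    by (intro sum_mono norm_le_l1_cart)
  finally show ?thesis .
qed

text \<open>
  The columns of the Jacobian are the directional derivatives of \<open>F\<close> along the coordinate axes, so
  their linearizations at \<open>\<alpha>\<close> can be assembled into one linear map \<open>L\<close>, which stands for
  the second derivative \<open>F''(\<alpha>)\<close>.
\<close>

lemma jacobian_expansion:
  fixes F :: "real^'n \<Rightarrow> real^'n"
  assumes D: "open D" "\<alpha> \<in> D" and F: "Ck_on 3 D F"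
  obtains L :: "real^'n \<Rightarrow> real^'n^'n" where "linear L"
    and "(\<lambda>u. norm (jacobian F (at u) - jacobian F (at \<alpha>) - L (u - \<alpha>)))
           \<in> O[nhds \<alpha>](\<lambda>u. norm (u - \<alpha>) ^ 2)"
proof -
  define g where "g j = (\<lambda>x. frechet_derivative F (at x) (axis j 1))" for j
  define L where "L v = (\<chi> i j. frechet_derivative (g j) (at \<alpha>) v $ i)" for v
  have C2: "Ck_on 2 D (g j)" for j
    unfolding g_def by (rule Ck_on_3_columns[OF F])
  have lin: "linear (frechet_derivative (g j) (at \<alpha>))" for j
    using Ck_on_2_differentiable[OF C2 D(2)] by (rule linear_frechet_derivative)
  have linL: "linear L"
    by (rule linearI) (simp_all add: L_def vec_eq_iff linear_add[OF lin] linear_scale[OF lin])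
  define R where "R j u = g j u - g j \<alpha> - frechet_derivative (g j) (at \<alpha>) (u - \<alpha>)" for j u
  have entry: "(jacobian F (at u) - jacobian F (at \<alpha>) - L (u - \<alpha>)) $ i $ j = R j u $ i" for u i j
    by (simp add: jacobian_def matrix_def L_def g_def R_def)
  have "norm (norm (jacobian F (at u) - jacobian F (at \<alpha>) - L (u - \<alpha>)))
      \<le> norm (\<Sum>i\<in>(UNIV::'n set). \<Sum>j\<in>UNIV. norm (R j u))" for u
  proof -
    have "norm (jacobian F (at u) - jacobian F (at \<alpha>) - L (u - \<alpha>))
        \<le> (\<Sum>i\<in>UNIV. \<Sum>j\<in>UNIV. \<bar>R j u $ i\<bar>)"
      by (rule order_trans[OF norm_matrix_le_sum]) (unfold entry, rule order_refl)
    also have "\<dots> \<le> (\<Sum>i\<in>(UNIV::'n set). \<Sum>j\<in>UNIV. norm (R j u))"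
      by (intro sum_mono component_le_norm_cart)
    finally show ?thesis
      by (simp add: sum_nonneg)
  qed
  then have "(\<lambda>u. norm (jacobian F (at u) - jacobian F (at \<alpha>) - L (u - \<alpha>)))
      \<in> O[nhds \<alpha>](\<lambda>u. \<Sum>i\<in>(UNIV::'n set). \<Sum>j\<in>UNIV. norm (R j u))"
    by (intro landau_o.big_mono always_eventually) blast
  also have "(\<lambda>u. \<Sum>i\<in>(UNIV::'n set). \<Sum>j\<in>UNIV. norm (R j u)) \<in> O[nhds \<alpha>](\<lambda>u. norm (u - \<alpha>) ^ 2)"
  proof (intro big_sum_in_bigo)
    fix j
    show "(\<lambda>u. norm (R j u)) \<in> O[nhds \<alpha>](\<lambda>u. norm (u - \<alpha>) ^ 2)"
      unfolding R_def by (rule Ck_on_2_linearization_error[OF D C2])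
  qed
  finally show ?thesis
    using that linL by blast
qed

lemma continuous_on_jacobian:
  fixes F :: "real^'n \<Rightarrow> real^'n"
  assumes "Ck_on 3 D F"
  shows "continuous_on D (\<lambda>x. jacobian F (at x))"
proof -
  have "continuous_on D (\<lambda>x. frechet_derivative F (at x) (axis j 1))" for j
    by (intro continuous_at_imp_continuous_on ballI differentiable_imp_continuous_within
        Ck_on_2_differentiable[OF Ck_on_3_columns(2)[OF assms]])
  then show ?thesis
    unfolding jacobian_def matrix_def by (intro continuous_intros)
qed

text \<open>
  The second part is the secant equation, the fundamental theorem of calculus along the segment.
\<close>

lemma divdiff_works:
  fixes F :: "real^'n \<Rightarrow> real^'n"
  assumes F: "Ck_on 3 D F" and seg: "closed_segment b a \<subseteq> D"
  shows "((\<lambda>t. jacobian F (at (b + t *\<^sub>R (a - b)))) has_integral divdiff F a b) {0..1}"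
    and "divdiff F a b *v (a - b) = F a - F b"
proof -
  let ?\<gamma> = "\<lambda>t. b + t *\<^sub>R (a - b)"
  have \<gamma>: "?\<gamma> t \<in> D" if "t \<in> {0..1}" for t
    using seg that by (force simp: closed_segment_def algebra_simps)
  have "continuous_on {0..1} ((\<lambda>x. jacobian F (at x)) \<circ> ?\<gamma>)"
    using \<gamma> by (intro continuous_on_compose continuous_intros
        continuous_on_subset[OF continuous_on_jacobian[OF F]]) auto
  then show int: "((\<lambda>t. jacobian F (at (?\<gamma> t))) has_integral divdiff F a b) {0..1}"
    unfolding divdiff_def by (intro integrable_integral integrable_continuous_interval) (simp add: o_def)
  have "((\<lambda>t. jacobian F (at (?\<gamma> t)) *v (a - b)) has_integral F (?\<gamma> 1) - F (?\<gamma> 0)) {0..1}"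
  proof (rule fundamental_theorem_of_calculus)
    fix t :: real assume t: "t \<in> {0..1}"
    have "(F has_derivative (\<lambda>h. jacobian F (at (?\<gamma> t)) *v h)) (at (?\<gamma> t))"
      using Ck_on_3_columns(1)[OF F \<gamma>[OF t]] jacobian_works by blast
    moreover have "(?\<gamma> has_derivative (\<lambda>h. h *\<^sub>R (a - b))) (at t within {0..1})"
      by (auto intro!: derivative_eq_intros)
    ultimately show "((\<lambda>t. F (?\<gamma> t)) has_vector_derivative jacobian F (at (?\<gamma> t)) *v (a - b)) (at t within {0..1})"
      unfolding has_vector_derivative_def
      using has_derivative_compose[of ?\<gamma> "\<lambda>h. h *\<^sub>R (a - b)" t "{0..1}" F
          "\<lambda>h. jacobian F (at (?\<gamma> t)) *v h"]
      by (simp add: matrix_vector_mult_scaleR)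
  qed simp
  moreover have "bounded_linear (\<lambda>M::real^'n^'n. M *v (a - b))"
    unfolding linear_conv_bounded_linear[symmetric]
    by (rule linearI) (simp_all add: matrix_vector_mult_add_rdistrib scaleR_matrix_vector_assoc)
  from has_integral_linear[OF int this]
  have "((\<lambda>t. jacobian F (at (?\<gamma> t)) *v (a - b)) has_integral divdiff F a b *v (a - b)) {0..1}"
    by (simp add: o_def)
  ultimately show "divdiff F a b *v (a - b) = F a - F b"
    by (auto dest: has_integral_unique)
qed

text \<open>
  Averaging the linear part of the Jacobian over the segment gives its value at the midpoint. Hence
  the term of first order depends on the sum of the two errors only, and it disappears when
  the end points lie symmetrically about \<open>\<alpha>\<close>. The methods exploit this twice, in the choice of
  \<open>\<delta>\<close> and in the Kurchatov divided difference.
\<close>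

lemma divdiff_expansion:
  fixes F :: "real^'n \<Rightarrow> real^'n"
  assumes D: "open D" "\<alpha> \<in> D" and F: "Ck_on 3 D F"
  obtains L :: "real^'n \<Rightarrow> real^'n^'n" and r K :: real
  where "linear L" and "r > 0" and "ball \<alpha> r \<subseteq> D"
    and "\<And>a b. a \<in> ball \<alpha> r \<Longrightarrow> b \<in> ball \<alpha> r \<Longrightarrow>
           norm (divdiff F a b - jacobian F (at \<alpha>) - (1 / 2) *\<^sub>R L ((a - \<alpha>) + (b - \<alpha>)))
             \<le> K * (norm (a - \<alpha>) + norm (b - \<alpha>)) ^ 2"
proof -
  let ?\<Gamma> = "jacobian F (at \<alpha>)"
  obtain L :: "real^'n \<Rightarrow> real^'n^'n" where L: "linear L"
    and "(\<lambda>u. norm (jacobian F (at u) - ?\<Gamma> - L (u - \<alpha>))) \<in> O[nhds \<alpha>](\<lambda>u. norm (u - \<alpha>) ^ 2)"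
    by (rule jacobian_expansion[OF assms])
  then obtain K where K: "K > 0"
    and ev: "\<forall>\<^sub>F u in nhds \<alpha>. norm (norm (jacobian F (at u) - ?\<Gamma> - L (u - \<alpha>))) \<le> K * norm (norm (u - \<alpha>) ^ 2)"
    by (elim landau_o.bigE)
  from ev have "\<forall>\<^sub>F u in nhds \<alpha>. u \<in> D \<and> norm (jacobian F (at u) - ?\<Gamma> - L (u - \<alpha>)) \<le> K * norm (u - \<alpha>) ^ 2"
    using eventually_nhds_in_open[OF D] by eventually_elim auto
  then obtain r where r: "r > 0" and near: "\<And>u. dist u \<alpha> < r \<Longrightarrow>
      u \<in> D \<and> norm (jacobian F (at u) - ?\<Gamma> - L (u - \<alpha>)) \<le> K * norm (u - \<alpha>) ^ 2"
    unfolding eventually_nhds_metric by blast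
  have ball: "ball \<alpha> r \<subseteq> D"
    using near by (auto simp: dist_commute)
  have "norm (divdiff F a b - ?\<Gamma> - (1 / 2) *\<^sub>R L ((a - \<alpha>) + (b - \<alpha>)))
      \<le> K * (norm (a - \<alpha>) + norm (b - \<alpha>)) ^ 2"
    if a: "a \<in> ball \<alpha> r" and b: "b \<in> ball \<alpha> r" for a b
  proof -
    let ?\<gamma> = "\<lambda>t. b + t *\<^sub>R (a - b)"
    have seg: "closed_segment b a \<subseteq> ball \<alpha> r"
      using a b by (intro closed_segment_subset) auto
    have lin: "((\<lambda>t. L (b - \<alpha>) + t *\<^sub>R L (a - b)) has_integral
            (1 / 2) *\<^sub>R L ((a - \<alpha>) + (b - \<alpha>))) {0..1}"
    proof -
      have "((\<lambda>t. t *\<^sub>R L (a - b)) has_integral (1 / 2) *\<^sub>R L (a - b)) {0..1::real}"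
        using has_integral_scaleR_left[OF ident_has_integral[of 0 1], of "L (a - b)"] by simp
      from has_integral_add[OF has_integral_const_real[of "L (b - \<alpha>)" 0 1] this]
      have "((\<lambda>t. L (b - \<alpha>) + t *\<^sub>R L (a - b)) has_integral
          L (b - \<alpha>) + (1 / 2) *\<^sub>R L (a - b)) {0..1}"
        by simp
      also have "L (b - \<alpha>) + (1 / 2) *\<^sub>R L (a - b) = L ((b - \<alpha>) + (1 / 2) *\<^sub>R (a - b))"
        by (simp add: linear_add[OF L] linear_scale[OF L])
      also have "(b - \<alpha>) + (1 / 2) *\<^sub>R (a - b) = (1 / 2) *\<^sub>R ((a - \<alpha>) + (b - \<alpha>))"
        by (simp add: vec_eq_iff field_simps)
      finally show ?thesis
        by (simp add: linear_scale[OF L])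
    qed
    have bound: "norm (jacobian F (at (?\<gamma> t)) - ?\<Gamma> - (L (b - \<alpha>) + t *\<^sub>R L (a - b)))
        \<le> K * (norm (a - \<alpha>) + norm (b - \<alpha>)) ^ 2" if t: "t \<in> {0..1}" for t
    proof -
      have split: "?\<gamma> t - \<alpha> = (1 - t) *\<^sub>R (b - \<alpha>) + t *\<^sub>R (a - \<alpha>)"
        by (simp add: algebra_simps)
      have "norm (?\<gamma> t - \<alpha>) \<le> (1 - t) * norm (b - \<alpha>) + t * norm (a - \<alpha>)"
        unfolding split using t norm_triangle_ineq[of "(1 - t) *\<^sub>R (b - \<alpha>)" "t *\<^sub>R (a - \<alpha>)"] by simp
      also have "\<dots> \<le> 1 * norm (b - \<alpha>) + 1 * norm (a - \<alpha>)"
        using t by (intro add_mono mult_right_mono) auto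
      finally have le: "norm (?\<gamma> t - \<alpha>) \<le> norm (a - \<alpha>) + norm (b - \<alpha>)"
        by simp
      have "?\<gamma> t \<in> closed_segment b a"
        using t by (force simp: closed_segment_def algebra_simps)
      then have "dist (?\<gamma> t) \<alpha> < r"
        using seg by (auto simp: dist_commute)
      then have "norm (jacobian F (at (?\<gamma> t)) - ?\<Gamma> - L (?\<gamma> t - \<alpha>)) \<le> K * norm (?\<gamma> t - \<alpha>) ^ 2"
        using near by blast
      also have "L (?\<gamma> t - \<alpha>) = L (b - \<alpha>) + t *\<^sub>R L (a - b)"
        by (simp add: linear_add[OF L, symmetric] linear_scale[OF L, symmetric] algebra_simps)
      also have "K * norm (?\<gamma> t - \<alpha>) ^ 2 \<le> K * (norm (a - \<alpha>) + norm (b - \<alpha>)) ^ 2"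
        using K le by (intro mult_left_mono power_mono) auto
      finally show ?thesis .
    qed
    have "((\<lambda>t. jacobian F (at (?\<gamma> t)) - ?\<Gamma> - (L (b - \<alpha>) + t *\<^sub>R L (a - b))) has_integral
        divdiff F a b - ?\<Gamma> - (1 / 2) *\<^sub>R L ((a - \<alpha>) + (b - \<alpha>))) {0..1}"
      using seg ball has_integral_const_real[of ?\<Gamma> 0 1]
      by (intro has_integral_diff lin divdiff_works(1)[OF F]) auto
    from has_integral_bound_real[OF _ finite.emptyI this, of "K * (norm (a - \<alpha>) + norm (b - \<alpha>)) ^ 2"]
    show ?thesis
      using bound K by simp
  qed
  then show ?thesis
    using that[OF L r ball] by blast
qed

section \<open>Errors within one step\<close>

text \<open>
  The analysis of the methods uses \<open>F\<close> only through its divided differences near \<open>\<alpha>\<close>. This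
  locale records what it needs about them, the secant equation and the expansion of second order.
\<close>

locale simple_zero_expansion =
  fixes F :: "real^'n \<Rightarrow> real^'n" and D :: "(real^'n) set" and \<alpha> :: "real^'n"
    and \<Gamma> :: "real^'n^'n" and L :: "real^'n \<Rightarrow> real^'n^'n" and r K :: real
  assumes zero: "F \<alpha> = 0" and invertible_\<Gamma>: "invertible \<Gamma>" and linear_L: "linear L"
    and r: "r > 0" and ball: "ball \<alpha> r \<subseteq> D"
    and secant: "\<And>a b. a \<in> ball \<alpha> r \<Longrightarrow> b \<in> ball \<alpha> r \<Longrightarrow> divdiff F a b *v (a - b) = F a - F b"
    and expansion: "\<And>a b. a \<in> ball \<alpha> r \<Longrightarrow> b \<in> ball \<alpha> r \<Longrightarrow>
           norm (divdiff F a b - \<Gamma> - (1 / 2) *\<^sub>R L ((a - \<alpha>) + (b - \<alpha>)))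
             \<le> K * (norm (a - \<alpha>) + norm (b - \<alpha>)) ^ 2"
begin

lemma eventually_in_ball: "(a \<longlongrightarrow> \<alpha>) G \<Longrightarrow> \<forall>\<^sub>F i in G. a i \<in> ball \<alpha> r"
  using r by (intro topological_tendstoD) auto

lemma eventually_segment_subset:
  assumes "(a \<longlongrightarrow> \<alpha>) G" and "(b \<longlongrightarrow> \<alpha>) G"
  shows "\<forall>\<^sub>F i in G. closed_segment (a i) (b i) \<subseteq> D"
  using eventually_in_ball[OF assms(1)] eventually_in_ball[OF assms(2)]
proof eventually_elim
  case (elim i)
  then have "closed_segment (a i) (b i) \<subseteq> ball \<alpha> r"
    by (intro closed_segment_subset) auto
  then show ?case
    using ball by blast
qed

lemma eventually_F_eq:
  assumes "(a \<longlongrightarrow> \<alpha>) G"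
  shows "\<forall>\<^sub>F i in G. F (a i) = divdiff F (a i) \<alpha> *v (a i - \<alpha>)"
  using eventually_in_ball[OF assms]
  by eventually_elim (use secant[of _ \<alpha>] zero r in auto)

lemma norm_bigo_L: "norm_bigo G f g \<Longrightarrow> norm_bigo G (\<lambda>i. (1 / 2) *\<^sub>R L (f i)) g"
  using norm_bigo_bounded_linear[of L f G g] linear_L
  by (simp add: linear_conv_bounded_linear)

lemma divdiff_second_order:
  assumes a: "norm_bigo G (\<lambda>i. a i - \<alpha>) g" and b: "norm_bigo G (\<lambda>i. b i - \<alpha>) g"
    and g: "(g \<longlongrightarrow> 0) G"
  shows "norm_bigo G (\<lambda>i. divdiff F (a i) (b i) - \<Gamma> - (1 / 2) *\<^sub>R L ((a i - \<alpha>) + (b i - \<alpha>)))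
           (\<lambda>i. g i ^ 2)"
proof -
  have lim: "(a \<longlongrightarrow> \<alpha>) G" "(b \<longlongrightarrow> \<alpha>) G"
    by (rule norm_bigo_diff_imp_tendsto[OF _ g], fact)+
  have "norm_bigo G (\<lambda>i. divdiff F (a i) (b i) - \<Gamma> - (1 / 2) *\<^sub>R L ((a i - \<alpha>) + (b i - \<alpha>)))
      (\<lambda>i. (norm (a i - \<alpha>) + norm (b i - \<alpha>)) ^ 2)"
  proof (rule bigoI[where c = K])
    show "\<forall>\<^sub>F i in G. norm (norm (divdiff F (a i) (b i) - \<Gamma> - (1 / 2) *\<^sub>R L ((a i - \<alpha>) + (b i - \<alpha>))))
        \<le> K * norm ((norm (a i - \<alpha>) + norm (b i - \<alpha>)) ^ 2)"
      using eventually_in_ball[OF lim(1)] eventually_in_ball[OF lim(2)]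
      by eventually_elim (use expansion in auto)
  qed
  then show ?thesis
    by (rule landau_o.big_trans[OF _ landau_o.big_power[OF sum_in_bigo(1)[OF a b]]])
qed

lemma divdiff_first_order:
  assumes a: "norm_bigo G (\<lambda>i. a i - \<alpha>) g" and b: "norm_bigo G (\<lambda>i. b i - \<alpha>) g"
    and g: "(g \<longlongrightarrow> 0) G"
  shows "norm_bigo G (\<lambda>i. divdiff F (a i) (b i) - \<Gamma>) g"
proof -
  have "(\<lambda>i. g i ^ 2) \<in> O[G](g)"
    unfolding power2_eq_square by (rule bigo_mult_bounded[OF tendsto_zero_imp_bigo_1[OF g]])
  with divdiff_second_order[OF a b g]
  have "norm_bigo G (\<lambda>i. divdiff F (a i) (b i) - \<Gamma> - (1 / 2) *\<^sub>R L ((a i - \<alpha>) + (b i - \<alpha>))) g"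
    by (rule landau_o.big_trans)
  from norm_bigo_add[OF this norm_bigo_L[OF norm_bigo_add[OF a b]]] show ?thesis
    by simp
qed

end

text \<open>
  A family of steps with starting points \<open>x i\<close> and parameters \<open>\<beta> = - B i\<close>, \<open>\<delta> = 2 * B i\<close>, where
  \<open>B i\<close> approximates the inverse of \<open>\<Gamma>\<close> up to a relative error of order \<open>\<tau> i\<close>. All estimates are
  asymptotic along the filter \<open>G\<close>; in the application \<open>i\<close> is the pair of the two latest
  iterates and \<open>G\<close> the neighbourhood filter of \<open>(\<alpha>, \<alpha>)\<close>.
\<close>

locale sw_step_family = simple_zero_expansion F D \<alpha> \<Gamma> L r K
  for F :: "real^'n \<Rightarrow> real^'n" and D \<alpha> \<Gamma> L r K +
  fixes G :: "'i filter" and x :: "'i \<Rightarrow> real^'n" and B :: "'i \<Rightarrow> real^'n^'n" and \<tau> :: "'i \<Rightarrow> real"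
  assumes x_lim: "(x \<longlongrightarrow> \<alpha>) G"
    and B_err: "norm_bigo G (\<lambda>i. mat 1 - B i ** \<Gamma>) \<tau>"
    and \<tau>_nonneg: "\<And>i. \<tau> i \<ge> 0" and \<tau>_lim: "(\<tau> \<longlongrightarrow> 0) G"
begin

text \<open>
  The error sizes: \<open>e\<close> is the current error, \<open>\<theta>\<close> the relative error of a Newton-like step with the
  fixed matrix \<open>B i\<close>, and \<open>\<rho> * e\<^sup>2\<close> turns out to be the factor gained in each later correction.
\<close>

definition "e i = norm (x i - \<alpha>)"
definition "\<theta> i = \<tau> i + e i"
definition "\<rho> i = \<theta> i ^ 2 + e i"
definition "w i = sw_w F (- B i) (x i)"
definition "z i = sw_z1 F (- B i) (x i)"
definition "v i = sw_v F (- B i) (2 *\<^sub>R B i) (x i)"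
definition "W i = divdiff F (w i) (x i)"
definition "V i = divdiff F (z i) (v i)"
definition "t i = sw_t F (- B i) (2 *\<^sub>R B i) (x i)"

lemma e_nonneg: "e i \<ge> 0"
  by (simp add: e_def)

lemma e_lim: "(e \<longlongrightarrow> 0) G"
  unfolding e_def using x_lim by (simp add: LIM_zero tendsto_norm_zero)

lemma \<theta>_lim: "(\<theta> \<longlongrightarrow> 0) G"
  unfolding \<theta>_def using tendsto_add[OF \<tau>_lim e_lim] by simp

lemma \<rho>_lim: "(\<rho> \<longlongrightarrow> 0) G"
  unfolding \<rho>_def using tendsto_add[OF tendsto_power[OF \<theta>_lim, of 2] e_lim] by simp

lemmas e_bounded = tendsto_zero_imp_bigo_1[OF e_lim]
  and \<theta>_bounded = tendsto_zero_imp_bigo_1[OF \<theta>_lim]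
  and \<rho>_bounded = tendsto_zero_imp_bigo_1[OF \<rho>_lim]

lemma \<tau>_le_\<theta>: "\<tau> \<in> O[G](\<theta>)"
  and e_le_\<theta>: "e \<in> O[G](\<theta>)"
  and e_le_\<rho>: "e \<in> O[G](\<rho>)"
  and \<theta>2_le_\<rho>: "(\<lambda>i. \<theta> i ^ 2) \<in> O[G](\<rho>)"
  by (rule landau_o.big_mono; rule always_eventually;
      use \<tau>_nonneg e_nonneg in \<open>simp add: \<theta>_def \<rho>_def\<close>)+

lemma \<rho>_le_\<theta>: "\<rho> \<in> O[G](\<theta>)"
  unfolding \<rho>_def power2_eq_square
  by (intro sum_in_bigo bigo_mult_bounded \<theta>_bounded e_le_\<theta>)

lemma x_err: "norm_bigo G (\<lambda>i. x i - \<alpha>) e"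
  unfolding e_def[abs_def] by simp

lemma \<alpha>_err: "norm_bigo G (\<lambda>i. \<alpha> - \<alpha>) g"
  by simp

lemma B_bounded: "norm_bigo G B (\<lambda>_. 1)"
proof -
  have "norm_bigo G (\<lambda>i. mat 1 - (mat 1 - B i ** \<Gamma>)) (\<lambda>_. 1)"
    by (rule norm_bigo_diff[OF _ landau_o.big_trans[OF B_err tendsto_zero_imp_bigo_1[OF \<tau>_lim]]]) simp
  then have "norm_bigo G (\<lambda>i. (B i ** \<Gamma>) ** matrix_inv \<Gamma>) (\<lambda>i. 1 * 1)"
    by (intro norm_bigo_matrix_mult) simp_all
  then show ?thesis
    by (simp add: matrix_mul_assoc[symmetric] matrix_inv_inverse[OF invertible_\<Gamma>])
qed

text \<open>
  By the secant equation the new error is \<open>mat 1 - B i ** divdiff F (a i) \<alpha>\<close> applied to the old one.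
  Both \<open>w\<close> and \<open>v\<close> are of this type: \<open>w\<close> is such a step from \<open>x\<close>, and \<open>v\<close> a step of double length from
  \<open>z\<close>.
\<close>

lemma chord_step_err:
  assumes a: "norm_bigo G (\<lambda>i. a i - \<alpha>) g" and g: "(g \<longlongrightarrow> 0) G" "g \<in> O[G](\<theta>)"
  shows "norm_bigo G (\<lambda>i. a i - B i *v F (a i) - \<alpha>) (\<lambda>i. \<theta> i * g i)"
proof -
  let ?Q = "\<lambda>i. divdiff F (a i) \<alpha>"
  have "norm_bigo G (\<lambda>i. B i ** (?Q i - \<Gamma>)) (\<lambda>i. 1 * g i)"
    by (intro norm_bigo_matrix_mult B_bounded divdiff_first_order a \<alpha>_err g)
  then have "norm_bigo G (\<lambda>i. B i ** (?Q i - \<Gamma>)) \<theta>"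
    using landau_o.big_trans[OF _ g(2)] by simp
  from norm_bigo_diff[OF landau_o.big_trans[OF B_err \<tau>_le_\<theta>] this]
  have "norm_bigo G (\<lambda>i. mat 1 - B i ** ?Q i) \<theta>"
    by (simp add: matrix_diff_ldistrib)
  from norm_bigo_matrix_vector_mult[OF this a]
  show ?thesis
  proof (rule norm_bigo_cong)
    show "\<forall>\<^sub>F i in G. a i - B i *v F (a i) - \<alpha> = (mat 1 - B i ** ?Q i) *v (a i - \<alpha>)"
      using eventually_F_eq[OF norm_bigo_diff_imp_tendsto[OF a g(1)]]
      by eventually_elim
        (simp add: matrix_vector_mult_diff_rdistrib matrix_vector_mul_assoc[symmetric])
  qed
qed

lemma w_err: "norm_bigo G (\<lambda>i. w i - \<alpha>) (\<lambda>i. \<theta> i * e i)"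
proof -
  have "w i = x i - B i *v F (x i)" for i
    using matrix_vector_mult_diff_rdistrib[of 0 "B i"] by (simp add: w_def sw_w_def)
  then show ?thesis
    using chord_step_err[OF x_err e_lim e_le_\<theta>] by simp
qed

lemma w_err_coarse: "norm_bigo G (\<lambda>i. w i - \<alpha>) e"
  by (rule landau_o.big_trans[OF w_err bigo_mult_bounded[OF \<theta>_bounded]])

lemma W_err: "norm_bigo G (\<lambda>i. W i - \<Gamma>) e"
  unfolding W_def by (rule divdiff_first_order[OF w_err_coarse x_err e_lim])

lemmas W_invertible = matrix_inv_bounded_near_invertible(1)
    [OF invertible_\<Gamma> norm_bigo_diff_imp_tendsto[OF W_err e_lim]]
  and W_inv_bounded = matrix_inv_bounded_near_invertible(2)
    [OF invertible_\<Gamma> norm_bigo_diff_imp_tendsto[OF W_err e_lim]]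

text \<open>
  The error of \<open>z\<close> is \<open>matrix_inv (W i)\<close> times \<open>W i - divdiff F (x i) \<alpha>\<close> times the error of \<open>x\<close>. The two
  divided differences share the end point \<open>x i\<close>, so up to second order they differ only by the
  error of \<open>w\<close>, which is already as small as \<open>\<theta> * e\<close>.
\<close>

lemma z_err: "norm_bigo G (\<lambda>i. z i - \<alpha>) (\<lambda>i. \<theta> i * e i ^ 2)"
proof -
  let ?Q = "\<lambda>i. divdiff F (x i) \<alpha>"
  have e2: "(\<lambda>i. e i ^ 2) \<in> O[G](\<lambda>i. \<theta> i * e i)"
    unfolding power2_eq_square by (rule landau_o.big.mult_right[OF e_le_\<theta>])
  have "norm_bigo G (\<lambda>i. (W i - \<Gamma> - (1 / 2) *\<^sub>R L ((w i - \<alpha>) + (x i - \<alpha>)))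
          - (?Q i - \<Gamma> - (1 / 2) *\<^sub>R L ((x i - \<alpha>) + (\<alpha> - \<alpha>)))
          + (1 / 2) *\<^sub>R L (w i - \<alpha>)) (\<lambda>i. \<theta> i * e i)"
    unfolding W_def
    by (intro norm_bigo_add norm_bigo_diff norm_bigo_L w_err
        landau_o.big_trans[OF divdiff_second_order e2] w_err_coarse x_err \<alpha>_err e_lim)
  moreover have "(a - g - (p + q)) - (b - g - q) + p = a - b" for a b g p q :: "real^'n^'n"
    by (simp add: algebra_simps)
  ultimately have "norm_bigo G (\<lambda>i. W i - ?Q i) (\<lambda>i. \<theta> i * e i)"
    unfolding diff_self add_0_right unfolding linear_add[OF linear_L] scaleR_add_right by simp
  from norm_bigo_matrix_vector_mult[OF W_inv_bounded norm_bigo_matrix_vector_mult[OF this x_err]]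
  have "norm_bigo G (\<lambda>i. matrix_inv (W i) *v ((W i - ?Q i) *v (x i - \<alpha>))) (\<lambda>i. \<theta> i * e i ^ 2)"
    by (simp add: power2_eq_square mult.assoc)
  then show ?thesis
  proof (rule norm_bigo_cong)
    show "\<forall>\<^sub>F i in G. z i - \<alpha> = matrix_inv (W i) *v ((W i - ?Q i) *v (x i - \<alpha>))"
      using eventually_F_eq[OF x_lim] W_invertible
    proof eventually_elim
      case (elim i)
      have "matrix_inv (W i) *v ((W i - ?Q i) *v (x i - \<alpha>))
          = (x i - \<alpha>) - matrix_inv (W i) *v F (x i)"
        using elim by (simp add: matrix_vector_mult_diff_rdistrib matrix_vector_mult_diff_distrib
            matrix_vector_mul_assoc matrix_inv_inverse)
      then show ?case
        by (simp add: z_def sw_z1_def W_def w_def)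
    qed
  qed
qed

text \<open>
  The size of the errors of \<open>z\<close> and \<open>v\<close>.
\<close>

definition "\<zeta> i = \<theta> i * e i ^ 2"

lemma \<zeta>_le_e: "\<zeta> \<in> O[G](e)"
proof -
  have "(\<lambda>i. (\<theta> i * e i) * e i) \<in> O[G](e)"
    by (intro bigo_mult_bounded landau_o.big.mult_in_1 \<theta>_bounded e_bounded)
  then show ?thesis
    by (simp add: \<zeta>_def[abs_def] power2_eq_square mult.assoc)
qed

lemmas \<zeta>_lim = bigo_imp_tendsto_0[OF \<zeta>_le_e e_lim]

lemma z_err': "norm_bigo G (\<lambda>i. z i - \<alpha>) \<zeta>"
  unfolding \<zeta>_def by (rule z_err)

text \<open>
  A single step from \<open>z\<close> with the matrix \<open>B\<close> would almost reach \<open>\<alpha>\<close>. The step to \<open>v\<close> is twice as long, so \<open>v\<close> is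
  almost the reflection of \<open>z\<close> in \<open>\<alpha>\<close>. This is the purpose of the factor \<open>2\<close> in \<open>\<delta>\<close>.
\<close>

lemma v_err_symmetric: "norm_bigo G (\<lambda>i. (z i - \<alpha>) + (v i - \<alpha>)) (\<lambda>i. \<theta> i ^ 2 * e i ^ 2)"
proof -
  have "norm_bigo G (\<lambda>i. z i - B i *v F (z i) - \<alpha>) (\<lambda>i. \<theta> i * \<zeta> i)"
    by (rule chord_step_err[OF z_err' \<zeta>_lim landau_o.big_trans[OF \<zeta>_le_e e_le_\<theta>]])
  then have "norm_bigo G (\<lambda>i. 2 *\<^sub>R (z i - B i *v F (z i) - \<alpha>)) (\<lambda>i. \<theta> i * \<zeta> i)"
    by simp
  moreover have "2 *\<^sub>R (z i - B i *v F (z i) - \<alpha>) = (z i - \<alpha>) + (v i - \<alpha>)" for i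
  proof -
    have v: "v i = z i - 2 *\<^sub>R (B i *v F (z i))"
      unfolding v_def sw_v_def z_def scaleR_matrix_vector_assoc by (rule refl)
    show ?thesis
      unfolding v by (simp add: scaleR_2 algebra_simps)
  qed
  ultimately show ?thesis
    by (simp add: \<zeta>_def[abs_def] power2_eq_square mult.assoc)
qed

lemma \<theta>2e2_le_\<zeta>: "(\<lambda>i. \<theta> i ^ 2 * e i ^ 2) \<in> O[G](\<zeta>)"
  using bigo_mult_bounded[OF \<theta>_bounded, of \<zeta>] by (simp add: \<zeta>_def[abs_def] power2_eq_square mult.assoc)

lemma v_err: "norm_bigo G (\<lambda>i. v i - \<alpha>) \<zeta>"
  using norm_bigo_diff[OF landau_o.big_trans[OF v_err_symmetric \<theta>2e2_le_\<zeta>] z_err'] by simp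

text \<open>
  The end points \<open>z\<close> and \<open>v\<close> being almost symmetric about \<open>\<alpha>\<close>, the term of first order nearly cancels,
  and \<open>V\<close> approximates \<open>\<Gamma>\<close> far better than \<open>z\<close> approximates \<open>\<alpha>\<close>.
\<close>

lemma V_err: "norm_bigo G (\<lambda>i. V i - \<Gamma>) (\<lambda>i. \<theta> i ^ 2 * e i ^ 2)"
proof -
  have "(\<lambda>i. e i ^ 2 * (\<theta> i ^ 2 * e i ^ 2)) \<in> O[G](\<lambda>i. \<theta> i ^ 2 * e i ^ 2)"
    unfolding power2_eq_square[of "e _"]
    by (intro bigo_mult_bounded landau_o.big.mult_in_1 e_bounded)
  then have "(\<lambda>i. \<zeta> i ^ 2) \<in> O[G](\<lambda>i. \<theta> i ^ 2 * e i ^ 2)"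
    by (simp add: \<zeta>_def[abs_def] power2_eq_square mult_ac)
  then have "norm_bigo G (\<lambda>i. V i - \<Gamma> - (1 / 2) *\<^sub>R L ((z i - \<alpha>) + (v i - \<alpha>))) (\<lambda>i. \<theta> i ^ 2 * e i ^ 2)"
    unfolding V_def by (rule landau_o.big_trans[OF divdiff_second_order[OF z_err' v_err \<zeta>_lim]])
  from norm_bigo_add[OF this norm_bigo_L[OF v_err_symmetric]] show ?thesis
    by simp
qed

lemma V_err_coarse: "norm_bigo G (\<lambda>i. V i - \<Gamma>) e"
  by (rule landau_o.big_trans[OF V_err landau_o.big_trans[OF \<theta>2e2_le_\<zeta> \<zeta>_le_e]])

lemma t_eq: "t i = matrix_inv (W i) ** V i"
  by (simp add: t_def sw_t_def W_def V_def w_def z_def v_def)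

lemma t_err: "norm_bigo G (\<lambda>i. t i - mat 1) e"
proof -
  have "norm_bigo G (\<lambda>i. (V i - \<Gamma>) - (W i - \<Gamma>)) e"
    by (intro norm_bigo_diff V_err_coarse W_err)
  from norm_bigo_matrix_mult[OF W_inv_bounded this]
  have "norm_bigo G (\<lambda>i. matrix_inv (W i) ** (V i - W i)) e"
    by simp
  then show ?thesis
  proof (rule norm_bigo_cong)
    show "\<forall>\<^sub>F i in G. t i - mat 1 = matrix_inv (W i) ** (V i - W i)"
      using W_invertible
      by eventually_elim (simp add: t_eq matrix_diff_ldistrib matrix_inv_inverse)
  qed
qed

lemma step_defined: "\<forall>\<^sub>F i in G. sw_step_defined F D (- B i) (2 *\<^sub>R B i) (x i)"
proof -
  have "\<forall>\<^sub>F i in G. closed_segment (x i) (w i) \<subseteq> D"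
    by (rule eventually_segment_subset[OF x_lim norm_bigo_diff_imp_tendsto[OF w_err_coarse e_lim]])
  moreover have "\<forall>\<^sub>F i in G. closed_segment (v i) (z i) \<subseteq> D"
    by (rule eventually_segment_subset[OF norm_bigo_diff_imp_tendsto[OF v_err \<zeta>_lim]
          norm_bigo_diff_imp_tendsto[OF z_err' \<zeta>_lim]])
  ultimately show ?thesis
    using W_invertible
    by eventually_elim (simp add: sw_step_defined_def W_def w_def v_def z_def)
qed

end

text \<open>
  The expansion of a weight function is given on a punctured neighbourhood of the identity. It
  persists at the identity itself, where both sides vanish, so it may be composed with any family
  that tends to the identity.
\<close>

lemma weight_function_expansion:
  fixes H :: "real^'n^'n \<Rightarrow> real^'n^'n"
  assumes H: "weight_function H H1 H2"
    and t: "norm_bigo G (\<lambda>i. t i - mat 1) g" and g: "(g \<longlongrightarrow> 0) G"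
  shows "norm_bigo G (\<lambda>i. H (t i) - (H (mat 1) + H1 *\<^sub>R (t i - mat 1)
           + (H2 / 2) *\<^sub>R ((t i - mat 1) ** (t i - mat 1)))) (\<lambda>i. g i ^ 3)"
proof -
  let ?E = "\<lambda>t. H t - (H (mat 1) + H1 *\<^sub>R (t - mat 1) + (H2 / 2) *\<^sub>R ((t - mat 1) ** (t - mat 1)))"
  have "norm_bigo (at (mat 1)) ?E (\<lambda>t. norm (t - mat 1) ^ 3)"
    using H by (simp add: weight_function_def)
  then obtain c where "\<forall>\<^sub>F t in at (mat 1). norm (norm (?E t)) \<le> c * norm (norm (t - mat 1) ^ 3)"
    by (elim landau_o.bigE)
  then have "\<forall>\<^sub>F t in nhds (mat 1). norm (norm (?E t)) \<le> c * norm (norm (t - mat 1) ^ 3)"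
    unfolding eventually_at_filter
  proof eventually_elim
    case (elim t)
    \<comment> \<open>The ring structure on the type of matrices is componentwise, so its rules for \<open>0\<close> do not apply to \<open>**\<close>.\<close>
    have zero: "(0 :: real^'n^'n) ** 0 = 0"
      by (simp add: matrix_matrix_mult_def vec_eq_iff)
    show ?case
      by (cases "t = mat 1") (use elim zero in auto)
  qed
  moreover have "filterlim t (nhds (mat 1)) G"
    using norm_bigo_diff_imp_tendsto[OF t g] .
  ultimately have "\<forall>\<^sub>F i in G. norm (norm (?E (t i))) \<le> c * norm (norm (t i - mat 1) ^ 3)"
    by (rule eventually_compose_filterlim)
  then have "norm_bigo G (\<lambda>i. ?E (t i)) (\<lambda>i. norm (t i - mat 1) ^ 3)"
    by (rule bigoI)
  then show ?thesis
    by (rule landau_o.big_trans[OF _ landau_o.big_power[OF t]])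
qed

locale sw_weighted_step_family = sw_step_family F D \<alpha> \<Gamma> L r K G x B \<tau>
  for F :: "real^'n \<Rightarrow> real^'n" and D \<alpha> \<Gamma> L r K and G :: "'i filter" and x B \<tau> +
  fixes H :: "real^'n^'n \<Rightarrow> real^'n^'n"
  assumes weight: "weight_function H (- 1) 2" and H_1: "H (mat 1) = mat 1"
begin

text \<open>
  The matrix by which each correction multiplies the value of \<open>F\<close>, an approximate inverse of \<open>\<Gamma>\<close>.
\<close>

definition "P i = H (t i) ** matrix_inv (W i)"

text \<open>
  The values \<open>H (mat 1) = mat 1\<close>, \<open>H1 = -1\<close> and \<open>H2 = 2\<close> are the first coefficients of the Neumann series
  \<open>mat 1 - s + s ** s - \<dots>\<close> of the inverse of \<open>mat 1 + s\<close>. So \<open>H\<close> inverts \<open>t i\<close> up to a term of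
  third order in \<open>t i - mat 1\<close>, which has size \<open>e\<close>.
\<close>

lemma H_t_near_inverse: "norm_bigo G (\<lambda>i. H (t i) ** t i - mat 1) (\<lambda>i. e i ^ 3)"
  and H_t_bounded: "norm_bigo G (\<lambda>i. H (t i)) (\<lambda>_. 1)"
proof -
  define s where "s i = t i - mat 1" for i
  have s: "norm_bigo G s e"
    unfolding s_def by (rule t_err)
  have s_bounded: "norm_bigo G s (\<lambda>_. 1)"
    by (rule landau_o.big_trans[OF s e_bounded])
  have t: "t i = mat 1 + s i" for i
    by (simp add: s_def)
  have mat1: "norm_bigo G (\<lambda>i. mat 1 :: real^'n^'n) (\<lambda>_. 1)"
    by simp
  have t_bounded: "norm_bigo G t (\<lambda>_. 1)"
    by (rule tendsto_imp_norm_bigo_1[OF norm_bigo_diff_imp_tendsto[OF t_err e_lim]])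
  have R: "norm_bigo G (\<lambda>i. H (t i) - (mat 1 - s i + s i ** s i)) (\<lambda>i. e i ^ 3)"
    using weight_function_expansion[OF weight t_err e_lim] by (simp add: H_1 s_def)
  have e3: "(\<lambda>i. e i ^ 3) \<in> O[G](\<lambda>_. 1)"
    using landau_o.big_power[OF e_bounded, of 3] by simp
  have s2: "norm_bigo G (\<lambda>i. s i ** s i) (\<lambda>_. 1)"
    using norm_bigo_matrix_mult[OF s_bounded s_bounded] by simp
  from norm_bigo_add[OF landau_o.big_trans[OF R e3]
      norm_bigo_add[OF norm_bigo_diff[OF mat1 s_bounded] s2]]
  show "norm_bigo G (\<lambda>i. H (t i)) (\<lambda>_. 1)"
    by simp
  \<comment> \<open>The product of \<open>mat 1 - s + s ** s\<close> and \<open>mat 1 + s\<close> is \<open>mat 1 + s ** (s ** s)\<close>.\<close>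
  have "norm_bigo G (\<lambda>i. (H (t i) - (mat 1 - s i + s i ** s i)) ** t i + s i ** (s i ** s i)) (\<lambda>i. e i ^ 3)"
    using norm_bigo_matrix_mult[OF R t_bounded]
      norm_bigo_matrix_mult[OF s norm_bigo_matrix_mult[OF s s]]
    by (intro norm_bigo_add) (simp_all add: power3_eq_cube mult.assoc)
  moreover have "(H (t i) - (mat 1 - s i + s i ** s i)) ** t i + s i ** (s i ** s i)
      = H (t i) ** t i - mat 1" for i
    by (simp add: t[of i] matrix_diff_rdistrib matrix_add_ldistrib matrix_add_rdistrib matrix_mul_assoc)
  ultimately show "norm_bigo G (\<lambda>i. H (t i) ** t i - mat 1) (\<lambda>i. e i ^ 3)"
    by simp
qed

lemma P_bounded: "norm_bigo G P (\<lambda>_. 1)"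
  using norm_bigo_matrix_mult[OF H_t_bounded W_inv_bounded] by (simp add: P_def[abs_def])

text \<open>
  Since \<open>t i = matrix_inv (W i) ** V i\<close>, the matrix \<open>P i\<close> inverts \<open>V i\<close> up to order \<open>e ^ 3\<close>: the poor
  approximation \<open>W\<close> is replaced by the good approximation \<open>V\<close>, without a second matrix inversion.
\<close>

lemma P_err: "norm_bigo G (\<lambda>i. mat 1 - P i ** \<Gamma>) (\<lambda>i. \<rho> i * e i ^ 2)"
proof -
  have "norm_bigo G (\<lambda>i. P i ** V i - mat 1) (\<lambda>i. e i * e i ^ 2)"
    using H_t_near_inverse by (simp add: P_def t_eq matrix_mul_assoc power3_eq_cube power2_eq_square mult.assoc)
  then have 1: "norm_bigo G (\<lambda>i. P i ** V i - mat 1) (\<lambda>i. \<rho> i * e i ^ 2)"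
    by (rule landau_o.big_trans) (rule landau_o.big.mult_right[OF e_le_\<rho>])
  have "norm_bigo G (\<lambda>i. P i ** (V i - \<Gamma>)) (\<lambda>i. 1 * (\<theta> i ^ 2 * e i ^ 2))"
    by (intro norm_bigo_matrix_mult P_bounded V_err)
  then have 2: "norm_bigo G (\<lambda>i. P i ** (V i - \<Gamma>)) (\<lambda>i. \<rho> i * e i ^ 2)"
    using landau_o.big_trans[OF _ landau_o.big.mult_right[OF \<theta>2_le_\<rho>]] by simp
  from norm_bigo_diff[OF 2 1] show ?thesis
    by (simp add: matrix_diff_ldistrib)
qed

text \<open>
  The error of \<open>a\<close> is multiplied by \<open>mat 1 - P i ** divdiff F (a i) \<alpha>\<close>. Its size is governed by the
  accuracy of \<open>P\<close> and by the error of \<open>a\<close> itself, which enters through the divided difference.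
\<close>

lemma corr_err:
  assumes a: "norm_bigo G (\<lambda>i. a i - \<alpha>) g" and g: "(g \<longlongrightarrow> 0) G" "g \<in> O[G](h)"
    and h: "(\<lambda>i. \<rho> i * e i ^ 2) \<in> O[G](h)"
  shows "norm_bigo G (\<lambda>i. sw_corr F H (- B i) (2 *\<^sub>R B i) (x i) (a i) - \<alpha>) (\<lambda>i. h i * g i)"
proof -
  let ?Q = "\<lambda>i. divdiff F (a i) \<alpha>"
  have "norm_bigo G (\<lambda>i. P i ** (?Q i - \<Gamma>)) (\<lambda>i. 1 * g i)"
    by (intro norm_bigo_matrix_mult P_bounded divdiff_first_order a \<alpha>_err g)
  then have "norm_bigo G (\<lambda>i. P i ** (?Q i - \<Gamma>)) h"
    using landau_o.big_trans[OF _ g(2)] by simp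
  from norm_bigo_diff[OF landau_o.big_trans[OF P_err h] this]
  have "norm_bigo G (\<lambda>i. mat 1 - P i ** ?Q i) h"
    by (simp add: matrix_diff_ldistrib)
  from norm_bigo_matrix_vector_mult[OF this a]
  show ?thesis
  proof (rule norm_bigo_cong)
    show "\<forall>\<^sub>F i in G. sw_corr F H (- B i) (2 *\<^sub>R B i) (x i) (a i) - \<alpha> = (mat 1 - P i ** ?Q i) *v (a i - \<alpha>)"
      using eventually_F_eq[OF norm_bigo_diff_imp_tendsto[OF a g(1)]]
      by eventually_elim
        (simp add: sw_corr_def P_def W_def w_def t_def matrix_vector_mult_diff_rdistrib
          matrix_vector_mul_assoc[symmetric])
  qed
qed

text \<open>
  The first correction is different from the others: the error of \<open>z\<close>, of size \<open>\<zeta>\<close>, exceeds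
  \<open>\<rho> * e\<^sup>2\<close>, so it is squared. From then on the error is at most of order \<open>\<rho> * e\<^sup>2\<close>, and each correction
  gains exactly this factor.
\<close>

lemma iterated_corr_err:
  "norm_bigo G (\<lambda>i. (sw_corr F H (- B i) (2 *\<^sub>R B i) (x i) ^^ Suc j) (z i) - \<alpha>)
     (\<lambda>i. \<rho> i ^ Suc j * e i ^ (2 * j + 4))"
proof (induction j)
  case 0
  have "norm_bigo G (\<lambda>i. sw_corr F H (- B i) (2 *\<^sub>R B i) (x i) (z i) - \<alpha>) (\<lambda>i. \<zeta> i * \<zeta> i)"
  proof (rule corr_err[OF z_err' \<zeta>_lim])
    show "(\<lambda>i. \<rho> i * e i ^ 2) \<in> O[G](\<zeta>)"
      unfolding \<zeta>_def by (rule landau_o.big.mult_right[OF \<rho>_le_\<theta>])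
  qed simp
  moreover have "(\<lambda>i. \<zeta> i * \<zeta> i) \<in> O[G](\<lambda>i. \<rho> i * e i ^ 4)"
    using landau_o.big.mult_right[OF \<theta>2_le_\<rho>, of "\<lambda>i. e i ^ 4"]
    by (simp add: \<zeta>_def[abs_def] power2_eq_square power4_eq_xxxx mult_ac)
  ultimately show ?case
    using landau_o.big_trans by simp
next
  case (Suc j)
  let ?g = "\<lambda>i. \<rho> i ^ Suc j * e i ^ (2 * j + 4)"
  have "(\<lambda>i. (\<rho> i ^ j * e i ^ (2 * j + 2)) * (\<rho> i * e i ^ 2)) \<in> O[G](\<lambda>i. \<rho> i * e i ^ 2)"
    using landau_o.big_power[OF \<rho>_bounded, of j] landau_o.big_power[OF e_bounded, of "2 * j + 2"]
    by (intro bigo_mult_bounded landau_o.big.mult_in_1) simp_all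
  then have g: "?g \<in> O[G](\<lambda>i. \<rho> i * e i ^ 2)"
    by (simp add: power_add power2_eq_square power4_eq_xxxx mult_ac)
  have "((\<lambda>i. \<rho> i * e i ^ 2) \<longlongrightarrow> 0) G"
    using tendsto_mult[OF \<rho>_lim tendsto_power[OF e_lim, of 2]] by simp
  note corr_err[OF Suc.IH bigo_imp_tendsto_0[OF g this] g landau_o.big_refl]
  moreover have "(\<rho> i * e i ^ 2) * ?g i = \<rho> i ^ Suc (Suc j) * e i ^ (2 * Suc j + 4)" for i
  proof -
    have "(\<rho> i * e i ^ 2) * ?g i = (\<rho> i * \<rho> i ^ Suc j) * (e i ^ 2 * e i ^ (2 * j + 4))"
      by (simp only: mult_ac)
    also have "e i ^ 2 * e i ^ (2 * j + 4) = e i ^ (2 * Suc j + 4)"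
      unfolding power_add[symmetric] by (rule arg_cong[where f = "power (e i)"]) simp
    finally show ?thesis
      by (simp only: power_Suc)
  qed
  ultimately show ?case
    by (simp only: funpow.simps o_apply)
qed

text \<open>
  In the application \<open>\<sigma>\<close> is a sum of powers of the last two errors; the mixed and the higher terms
  in \<open>\<rho>\<close> are absorbed.
\<close>

lemma step_err:
  assumes m: "m \<ge> 2" and \<sigma>: "(\<lambda>i. \<tau> i ^ 2) \<in> O[G](\<sigma>)" "e \<in> O[G](\<sigma>)"
  shows "norm_bigo G (\<lambda>i. sw_step F H m (- B i) (2 *\<^sub>R B i) (x i) - \<alpha>)
           (\<lambda>i. norm (x i - \<alpha>) ^ (2 * m) * \<sigma> i ^ (m - 1))"
proof -
  obtain j where j: "m = Suc (Suc j)"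
    using m by (metis One_nat_def Suc_1 Suc_le_D Suc_le_mono)
  have "\<rho> \<in> O[G](\<sigma>)"
  proof -
    have "(\<lambda>i. 2 * \<tau> i ^ 2 + 2 * (e i * e i)) \<in> O[G](\<sigma>)"
      by (intro sum_in_bigo) (simp_all add: \<sigma> landau_o.big_trans[OF bigo_mult_bounded[OF e_bounded] \<sigma>(2)])
    moreover have "(\<lambda>i. \<theta> i ^ 2) \<in> O[G](\<lambda>i. 2 * \<tau> i ^ 2 + 2 * (e i * e i))"
    proof (rule landau_o.big_mono, rule always_eventually, rule allI)
      fix i
      have "\<theta> i ^ 2 \<le> 2 * \<tau> i ^ 2 + 2 * (e i * e i)"
        using sum_squares_bound[of "\<tau> i" "e i"] by (simp add: \<theta>_def power2_eq_square algebra_simps)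
      then show "norm (\<theta> i ^ 2) \<le> norm (2 * \<tau> i ^ 2 + 2 * (e i * e i))"
        by simp
    qed
    ultimately show ?thesis
      unfolding \<rho>_def using \<sigma>(2) by (intro sum_in_bigo) (rule landau_o.big_trans)
  qed
  then have "(\<lambda>i. \<rho> i ^ Suc j * e i ^ (2 * j + 4)) \<in> O[G](\<lambda>i. \<sigma> i ^ Suc j * e i ^ (2 * j + 4))"
    by (intro landau_o.big.mult_right landau_o.big_power)
  moreover have "2 * m = 2 * j + 4" "m - 1 = Suc j"
    using j by simp_all
  ultimately show ?thesis
    using landau_o.big_trans[OF iterated_corr_err[of j]]
    by (simp only: sw_step_def z_def e_def mult.commute[of "norm _ ^ _"])
qed

end

section \<open>The methods with memory\<close>

context simple_zero_expansion
begin

lemma current_error_lim: "((\<lambda>p. norm (snd p - \<alpha>)) \<longlongrightarrow> 0) (nhds (\<alpha>, \<alpha>))"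
  and previous_error_lim: "((\<lambda>p. norm (fst p - \<alpha>)) \<longlongrightarrow> 0) (nhds (\<alpha>, \<alpha>))"
  using tendsto_snd[OF filterlim_ident, of "(\<alpha>, \<alpha>)"] tendsto_fst[OF filterlim_ident, of "(\<alpha>, \<alpha>)"]
  by (auto simp: LIM_zero tendsto_norm_zero)

text \<open>
  Squaring doubles the exponent of the previous error. The current error keeps exponent one, which
  is weak but harmless: in the long run the other summand dominates.
\<close>

lemma square_of_memory_error:
  "(\<lambda>p. (norm (snd p - \<alpha>) + norm (fst p - \<alpha>) ^ s) ^ 2)
     \<in> O[nhds (\<alpha>, \<alpha>)](\<lambda>p. norm (snd p - \<alpha>) + norm (fst p - \<alpha>) ^ (2 * s))"
proof (rule bigoI[where c = 2])
  have "\<forall>\<^sub>F p in nhds (\<alpha>, \<alpha>). norm (snd p - \<alpha>) < 1"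
    by (rule order_tendstoD[OF current_error_lim]) simp
  then show "\<forall>\<^sub>F p in nhds (\<alpha>, \<alpha>). norm ((norm (snd p - \<alpha>) + norm (fst p - \<alpha>) ^ s) ^ 2)
      \<le> 2 * norm (norm (snd p - \<alpha>) + norm (fst p - \<alpha>) ^ (2 * s))"
  proof eventually_elim
    case (elim p)
    define a b where "a = norm (snd p - \<alpha>)" and "b = norm (fst p - \<alpha>) ^ s"
    have ab: "0 \<le> a" "a \<le> 1" "norm (fst p - \<alpha>) ^ (2 * s) = b ^ 2"
      using elim by (simp_all add: a_def b_def power_mult mult.commute)
    have "(a + b) ^ 2 \<le> 2 * a ^ 2 + 2 * b ^ 2"
      using sum_squares_bound[of a b] by (simp add: power2_eq_square algebra_simps)
    also have "a ^ 2 \<le> a"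
      using ab by (simp add: power2_eq_square mult_left_le)
    finally show ?case
      using ab by (simp add: a_def[symmetric] b_def[symmetric])
  qed
qed

text \<open>
  What distinguishes one memory matrix \<open>M\<close> from another is the exponent \<open>s\<close> with which the previous error
  enters its distance from \<open>\<Gamma>\<close>. The predicate \<open>Q\<close> carries along the condition under which \<open>M\<close> is
  meaningful.
\<close>

lemma memory_method_R_order:
  fixes M :: "real^'n \<Rightarrow> real^'n \<Rightarrow> real^'n^'n" and H :: "real^'n^'n \<Rightarrow> real^'n^'n"
  assumes m: "m \<ge> 2" and H: "weight_function H (- 1) 2" "H (mat 1) = mat 1"
    and s: "1 \<le> s" "s \<le> 2"
    and M: "norm_bigo (nhds (\<alpha>, \<alpha>)) (\<lambda>p. M (fst p) (snd p) - \<Gamma>)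
              (\<lambda>p. norm (snd p - \<alpha>) + norm (fst p - \<alpha>) ^ s)"
    and Q: "\<forall>\<^sub>F p in nhds (\<alpha>, \<alpha>). Q (fst p) (snd p)"
  shows "\<exists>\<epsilon>>0. \<forall>xm1 x0. dist xm1 \<alpha> < \<epsilon> \<and> dist x0 \<alpha> < \<epsilon> \<longrightarrow>
           (let X = memory_iterates
                      (\<lambda>y x. sw_step F H m (- matrix_inv (M y x)) (2 *\<^sub>R matrix_inv (M y x)) x) xm1 x0
            in (\<forall>k. Q (X k) (X (Suc k)) \<and> invertible (M (X k) (X (Suc k))) \<and>
                    sw_step_defined F D (- matrix_inv (M (X k) (X (Suc k))))
                      (2 *\<^sub>R matrix_inv (M (X k) (X (Suc k)))) (X (Suc k))) \<and>
               converges_with_order (\<lambda>k. X (Suc k)) \<alpha>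
                 (real m + sqrt (real m ^ 2 + real (2 * s) * (real m - 1))))"
proof -
  let ?G = "nhds (\<alpha>, \<alpha>)"
  define \<tau> where "\<tau> p = norm (snd p - \<alpha>) + norm (fst p - \<alpha>) ^ s" for p
  define B where "B p = matrix_inv (M (fst p) (snd p))" for p
  have \<tau>_lim: "(\<tau> \<longlongrightarrow> 0) ?G"
    unfolding \<tau>_def using tendsto_add[OF current_error_lim tendsto_power[OF previous_error_lim, of s]] s
    by (simp add: zero_power)
  have M': "norm_bigo ?G (\<lambda>p. M (fst p) (snd p) - \<Gamma>) \<tau>"
    using M by (simp add: \<tau>_def[abs_def])
  note M_inv = matrix_inv_bounded_near_invertible
      [OF invertible_\<Gamma> norm_bigo_diff_imp_tendsto[OF M' \<tau>_lim], folded B_def]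
  have "norm_bigo ?G (\<lambda>p. B p ** (M (fst p) (snd p) - \<Gamma>)) (\<lambda>p. 1 * \<tau> p)"
    by (rule norm_bigo_matrix_mult[OF M_inv(2) M'])
  then have "norm_bigo ?G (\<lambda>p. B p ** (M (fst p) (snd p) - \<Gamma>)) \<tau>"
    by simp
  then have B_err: "norm_bigo ?G (\<lambda>p. mat 1 - B p ** \<Gamma>) \<tau>"
  proof (rule norm_bigo_cong)
    show "\<forall>\<^sub>F p in ?G. mat 1 - B p ** \<Gamma> = B p ** (M (fst p) (snd p) - \<Gamma>)"
      using M_inv(1) by eventually_elim (simp add: B_def matrix_diff_ldistrib matrix_inv_inverse)
  qed
  interpret sw_weighted_step_family F D \<alpha> \<Gamma> L r K ?G snd B \<tau> H
  proof
    show "(snd \<longlongrightarrow> \<alpha>) ?G"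
      using tendsto_snd[OF filterlim_ident, of "(\<alpha>, \<alpha>)"] by simp
    show "\<tau> p \<ge> 0" for p
      by (simp add: \<tau>_def)
  qed (fact B_err \<tau>_lim H)+
  have bound: "norm_bigo ?G (\<lambda>p. sw_step F H m (- B p) (2 *\<^sub>R B p) (snd p) - \<alpha>)
      (\<lambda>p. norm (snd p - \<alpha>) ^ (2 * m) * (norm (snd p - \<alpha>) + norm (fst p - \<alpha>) ^ (2 * s)) ^ (m - 1))"
  proof (rule step_err[OF m])
    show "(\<lambda>p. \<tau> p ^ 2) \<in> O[?G](\<lambda>p. norm (snd p - \<alpha>) + norm (fst p - \<alpha>) ^ (2 * s))"
      unfolding \<tau>_def by (rule square_of_memory_error)
    show "e \<in> O[?G](\<lambda>p. norm (snd p - \<alpha>) + norm (fst p - \<alpha>) ^ (2 * s))"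
      by (rule landau_o.big_mono) (simp add: e_def)
  qed
  have "2 * s \<ge> 1" "2 * s \<le> 2 * m"
    using s m by auto
  then show ?thesis
  proof (rule memory_method_local_R_order[OF m])
    show "\<forall>\<^sub>F (y, x) in ?G. Q y x \<and> invertible (M y x) \<and>
        sw_step_defined F D (- matrix_inv (M y x)) (2 *\<^sub>R matrix_inv (M y x)) x"
      using Q M_inv(1) step_defined by eventually_elim (auto simp: B_def)
    show "(\<lambda>(y, x). norm (sw_step F H m (- matrix_inv (M y x)) (2 *\<^sub>R matrix_inv (M y x)) x - \<alpha>))
        \<in> O[?G](\<lambda>(y, x). norm (x - \<alpha>) ^ (2 * m) * (norm (x - \<alpha>) + norm (y - \<alpha>) ^ (2 * s)) ^ (m - 1))"
      using bound by (simp add: B_def case_prod_beta')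
  qed
qed

lemma pair_errors:
  "norm_bigo (nhds (\<alpha>, \<alpha>)) (\<lambda>p. snd p - \<alpha>) (\<lambda>p. norm (snd p - \<alpha>) + norm (fst p - \<alpha>))"
  "norm_bigo (nhds (\<alpha>, \<alpha>)) (\<lambda>p. fst p - \<alpha>) (\<lambda>p. norm (snd p - \<alpha>) + norm (fst p - \<alpha>))"
  "((\<lambda>p. norm (snd p - \<alpha>) + norm (fst p - \<alpha>)) \<longlongrightarrow> 0) (nhds (\<alpha>, \<alpha>))"
  using tendsto_add[OF current_error_lim previous_error_lim]
  by (auto intro!: landau_o.big_mono)

lemma reflected_point_error:
  "norm_bigo (nhds (\<alpha>, \<alpha>)) (\<lambda>p. 2 *\<^sub>R snd p - fst p - \<alpha>)
     (\<lambda>p. norm (snd p - \<alpha>) + norm (fst p - \<alpha>))"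
proof -
  have "norm_bigo (nhds (\<alpha>, \<alpha>)) (\<lambda>p. 2 *\<^sub>R (snd p - \<alpha>) - (fst p - \<alpha>))
      (\<lambda>p. norm (snd p - \<alpha>) + norm (fst p - \<alpha>))"
    by (rule norm_bigo_diff[OF _ pair_errors(2)]) (simp add: pair_errors(1))
  then show ?thesis
    by (simp add: scaleR_2 algebra_simps)
qed

lemma secant_memory_error:
  "norm_bigo (nhds (\<alpha>, \<alpha>)) (\<lambda>p. divdiff F (snd p) (fst p) - \<Gamma>)
     (\<lambda>p. norm (snd p - \<alpha>) + norm (fst p - \<alpha>) ^ 1)"
  using divdiff_first_order[OF pair_errors] by simp

text \<open>
  The points \<open>2 *\<^sub>R x - y\<close> and \<open>y\<close> have midpoint \<open>x\<close>, so the term of first order involves the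
  error of \<open>x\<close> alone, and the error of \<open>y\<close> enters quadratically.
\<close>

lemma kurchatov_memory_error:
  "norm_bigo (nhds (\<alpha>, \<alpha>)) (\<lambda>p. kurchatov F (snd p) (fst p) - \<Gamma>)
     (\<lambda>p. norm (snd p - \<alpha>) + norm (fst p - \<alpha>) ^ 2)"
proof -
  let ?h = "\<lambda>p. norm (snd p - \<alpha>) + norm (fst p - \<alpha>) ^ 2"
  have midpoint: "(2 *\<^sub>R x - y - \<alpha>) + (y - \<alpha>) = 2 *\<^sub>R (x - \<alpha>)" for x y
    by (simp add: scaleR_2)
  have "norm_bigo (nhds (\<alpha>, \<alpha>)) (\<lambda>p. kurchatov F (snd p) (fst p) - \<Gamma>
          - (1 / 2) *\<^sub>R L ((2 *\<^sub>R snd p - fst p - \<alpha>) + (fst p - \<alpha>))) ?h"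
    unfolding kurchatov_def
    using landau_o.big_trans[OF divdiff_second_order[OF reflected_point_error pair_errors(2,3)]]
      square_of_memory_error[of 1] by simp
  moreover have "norm_bigo (nhds (\<alpha>, \<alpha>))
      (\<lambda>p. (1 / 2) *\<^sub>R L ((2 *\<^sub>R snd p - fst p - \<alpha>) + (fst p - \<alpha>))) ?h"
    unfolding midpoint by (intro norm_bigo_L) (auto intro!: landau_o.big_mono)
  ultimately show ?thesis
    using norm_bigo_add by fastforce
qed

end

theorem theorem2:
  fixes F :: "real^'n \<Rightarrow> real^'n" and D :: "(real^'n) set" and \<alpha> :: "real^'n"
    and H :: "real^'n^'n \<Rightarrow> real^'n^'n" and H1 H2 :: real and m :: nat
  assumes "m \<ge> 2"
    and "open D" and "\<alpha> \<in> D"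
    and "Ck_on 3 D F"
    and "F \<alpha> = 0"
    and "invertible (jacobian F (at \<alpha>))"
    and "weight_function H H1 H2"
    and "H (mat 1) = mat 1" and "H1 = -1" and "H2 = 2"
  shows "(\<exists>\<epsilon>>0. \<forall>xm1 x0. dist xm1 \<alpha> < \<epsilon> \<and> dist x0 \<alpha> < \<epsilon> \<longrightarrow>
            (let X = memory_iterates (swd_step F H m) xm1 x0
             in (\<forall>k. swd_step_defined F D (X k) (X (Suc k))) \<and>
                converges_with_order (\<lambda>k. X (Suc k)) \<alpha>
                  (real m + sqrt (real m ^ 2 + 2 * real m - 2)))) \<and>
         (\<exists>\<epsilon>>0. \<forall>xm1 x0. dist xm1 \<alpha> < \<epsilon> \<and> dist x0 \<alpha> < \<epsilon> \<longrightarrow>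
            (let X = memory_iterates (swk_step F H m) xm1 x0
             in (\<forall>k. swk_step_defined F D (X k) (X (Suc k))) \<and>
                converges_with_order (\<lambda>k. X (Suc k)) \<alpha>
                  (real m + sqrt (real m ^ 2 + 4 * real m - 4))))"
proof -
  obtain L r K where L: "linear L" and r: "r > 0" and ball: "ball \<alpha> r \<subseteq> D"
    and expansion: "\<And>a b. a \<in> ball \<alpha> r \<Longrightarrow> b \<in> ball \<alpha> r \<Longrightarrow>
           norm (divdiff F a b - jacobian F (at \<alpha>) - (1 / 2) *\<^sub>R L ((a - \<alpha>) + (b - \<alpha>)))
             \<le> K * (norm (a - \<alpha>) + norm (b - \<alpha>)) ^ 2"
    using divdiff_expansion[OF assms(2-4)] by metis
  have secant: "divdiff F a b *v (a - b) = F a - F b" if "a \<in> ball \<alpha> r" "b \<in> ball \<alpha> r" for a b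
  proof (rule divdiff_works(2)[OF assms(4)])
    have "closed_segment b a \<subseteq> ball \<alpha> r"
      using that by (intro closed_segment_subset) auto
    then show "closed_segment b a \<subseteq> D"
      using ball by blast
  qed
  interpret simple_zero_expansion F D \<alpha> "jacobian F (at \<alpha>)" L r K
    by (rule simple_zero_expansion.intro; fact assms(5,6) L r ball secant expansion)
  have H: "weight_function H (- 1) 2"
    using assms(7,9,10) by simp
  have lim: "(fst \<longlongrightarrow> \<alpha>) (nhds (\<alpha>, \<alpha>))" "(snd \<longlongrightarrow> \<alpha>) (nhds (\<alpha>, \<alpha>))"
    using tendsto_fst[OF filterlim_ident, of "(\<alpha>, \<alpha>)"]
      tendsto_snd[OF filterlim_ident, of "(\<alpha>, \<alpha>)"] by simp_all
  have order: "real m ^ 2 + 2 * real m - 2 = real m ^ 2 + real (2 * 1) * (real m - 1)"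
    "real m ^ 2 + 4 * real m - 4 = real m ^ 2 + real (2 * 2) * (real m - 1)"
    by (simp_all add: algebra_simps)
  have "\<forall>\<^sub>F p in nhds (\<alpha>, \<alpha>). closed_segment (fst p) (snd p) \<subseteq> D"
    by (rule eventually_segment_subset[OF lim])
  from memory_method_R_order[where M = "\<lambda>y x. divdiff F x y" and Q = "\<lambda>y x. closed_segment y x \<subseteq> D",
      OF assms(1) H assms(8) _ _ secant_memory_error this]
  have SWD: "\<exists>\<epsilon>>0. \<forall>xm1 x0. dist xm1 \<alpha> < \<epsilon> \<and> dist x0 \<alpha> < \<epsilon> \<longrightarrow>
            (let X = memory_iterates (swd_step F H m) xm1 x0
             in (\<forall>k. swd_step_defined F D (X k) (X (Suc k))) \<and>
                converges_with_order (\<lambda>k. X (Suc k)) \<alpha>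
                  (real m + sqrt (real m ^ 2 + 2 * real m - 2)))"
    unfolding order swd_step_def[abs_def] swd_step_defined_def by simp
  have "\<forall>\<^sub>F p in nhds (\<alpha>, \<alpha>). closed_segment (fst p) (2 *\<^sub>R snd p - fst p) \<subseteq> D"
    by (rule eventually_segment_subset[OF lim(1)
        norm_bigo_diff_imp_tendsto[OF reflected_point_error pair_errors(3)]])
  from memory_method_R_order[where M = "\<lambda>y x. kurchatov F x y"
      and Q = "\<lambda>y x. closed_segment y (2 *\<^sub>R x - y) \<subseteq> D",
      OF assms(1) H assms(8) _ _ kurchatov_memory_error this]
  have SWK: "\<exists>\<epsilon>>0. \<forall>xm1 x0. dist xm1 \<alpha> < \<epsilon> \<and> dist x0 \<alpha> < \<epsilon> \<longrightarrow>
            (let X = memory_iterates (swk_step F H m) xm1 x0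
             in (\<forall>k. swk_step_defined F D (X k) (X (Suc k))) \<and>
                converges_with_order (\<lambda>k. X (Suc k)) \<alpha>
                  (real m + sqrt (real m ^ 2 + 4 * real m - 4)))"
    unfolding order swk_step_def[abs_def] swk_step_defined_def by simp
  show ?thesis
    using SWD SWK by (rule conjI)
qed

end
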